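(* Let $A \subset \mathbb{R}$ be finite. Then $$|A-A| + |AA^{-1}| \gtrsim |A|^{1+3/10}, \qquad |A-A| + |AA| \gtrsim |A|^{1+7/24}.$$
   Context: $A-A=\{a-b: a,b\in A\}$, $AA = \{ab: a,b\in A\}$, $A^{-1} = \{a^{-1} : a\in A\}$ with the convention $0^{-1}=0$, and $AA^{-1}=\{ab: a\in A, b\in A^{-1}\}$. The notation $b \gtrsim a$ means $a = O(b \log^c |A|)$ for some absolute constant $c>0$. *)

theory Defs
  imports Complex_Main
begin

definition difference_set :: "real set \<Rightarrow> real set" where
  "difference_set A = {a - b | a b. a \<in> A \<and> b \<in> A}"

definition product_set :: "real set \<Rightarrow> real set \<Rightarrow> real set" where
  "product_set A B = {a * b | a b. a \<in> A \<and> b \<in> B}"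

(* The convention that 0 is its own inverse is the one built into the HOL inverse on reals. *)
definition inverse_set :: "real set \<Rightarrow> real set" where
  "inverse_set A = {inverse a | a. a \<in> A}"

(* gtrsim b a says a = O(b log^c |A|) for some absolute c > 0, where a and b are quantities
   depending on a finite set A of reals; the implied constant C, like c, does not depend on A.
   Sets with at most one element are excluded because log 1 = 0 would make the bound fail for
   singletons. *)
definition gtrsim :: "(real set \<Rightarrow> real) \<Rightarrow> (real set \<Rightarrow> real) \<Rightarrow> bool" (infix "\<greatersim>" 50) where
  "b \<greatersim> a \<longleftrightarrow>
     (\<exists>c>0. \<exists>C>0. \<forall>A. finite A \<and> card A \<ge> 2 \<longrightarrow>
        \<bar>a A\<bar> \<le> C * \<bar>b A * ln (real (card A)) powr c\<bar>)"

end

theory Submission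
  imports Defs "HOL-Analysis.Convex" "HOL-Analysis.Harmonic_Numbers"
begin

text \<open>
  Say that \<open>d\<close> bounds the cubic energy of \<open>A\<close> if \<open>E\<^sub>3(A, B) \<le> d |A| |B|\<^sup>2\<close> for all finite \<open>B\<close>, where
  \<open>E\<^sub>3(A, B)\<close> is the sum of the cubes of the representation function of \<open>A - B\<close>.
  Up to logarithms, \<open>|A - A| \<ge> |A|\<^bsup>8/5\<^esup> d\<^bsup>-3/5\<^esup>\<close> and \<open>|A + A| \<ge> |A|\<^bsup>11/7\<^esup> d\<^bsup>-4/7\<^esup>\<close>, by double counting and
  Cauchy-Schwarz alone. After passing to a set of positive numbers, the same holds for quotients and
  products by taking logarithms. Finally, for every \<open>K\<close> some
  \<open>X \<subseteq> A\<close> containing half of \<open>A\<close> has additive bound \<open>K\<close> or multiplicative bound about \<open>|A| / K\<close>; the link between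
  the two structures is the Szemeredi-Trotter bound, needed only for grids of points, where a
  partition into blocks proves it. The choices \<open>K = |A|\<^bsup>1/2\<^esup>\<close> and \<open>K = |A|\<^bsup>37/72\<^esup>\<close> give the theorem.
\<close>

subsection \<open>Incidences between grids and lines of positive slope\<close>

text \<open>Third energies serve both halves of the argument: collisions of three-variable maps are
  triples of pairs with a common difference, and the incidence bound is a bound on the cube of the
  number of incidences, hence makes level sets decay like \<open>t\<close> to the power -3. The
  bound is demanded for every \<open>B\<close> because the set itself, its difference set, its
  sumset and its sets of popular differences all occur in the role of \<open>B\<close>.

  Positivity is used twice: it makes logarithms available, and it makes the slopes
  \<open>exp x\<close> positive. A line of positive slope is an increasing graph, so it runs through
  the cells of a grid as a staircase; this replaces the cell decomposition of the general incidence
  theorem.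

  The dichotomy can fail for \<open>A\<close> itself, for instance when \<open>A\<close> is half an
  arithmetic and half a geometric progression. Failure of the additive bound on a set only yields
  some subset whose logarithms have small third energy. Such pieces are glued together until they
  fill half of \<open>A\<close>, or what is left over has the additive bound.\<close>

lemma card_le_image_plus_collisions:
  assumes "finite Z"
  shows "card Z \<le> card (f ` Z) + card {(p, q). p \<in> Z \<and> q \<in> Z \<and> p \<noteq> q \<and> f p = f q}"
proof -
  obtain W where W: "W \<subseteq> Z" "inj_on f W" "f ` W = f ` Z"
    by (metis subset_image_inj subset_refl)
  define g where "g p = (SOME q. q \<in> W \<and> f q = f p)" for p
  have g: "g p \<in> W \<and> f (g p) = f p" if "p \<in> Z" for p
  proof -
    have "f p \<in> f ` W" using that W(3) by simp
    then have "\<exists>q. q \<in> W \<and> f q = f p" by (metis imageE)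
    then show ?thesis unfolding g_def by (rule someI_ex)
  qed
  let ?P = "{(p, q). p \<in> Z \<and> q \<in> Z \<and> p \<noteq> q \<and> f p = f q}"
  have fin: "finite ?P" by (rule finite_subset[of _ "Z \<times> Z"]) (use assms in auto)
  \<comment> \<open>\<open>W\<close> holds one representative of each fibre. A point outside
    \<open>W\<close> differs from its representative, so it contributes a collision of its
    own.\<close>
  have "card (Z - W) = card ((\<lambda>p. (p, g p)) ` (Z - W))"
    by (rule card_image[symmetric]) (auto simp: inj_on_def)
  also have "\<dots> \<le> card ?P"
    by (rule card_mono[OF fin]) (use g W(1) in force)
  finally have "card (Z - W) \<le> card ?P" .
  moreover have "card W = card (f ` Z)" using card_image[OF W(2)] W(3) by simp
  moreover have "card Z = card W + card (Z - W)"
    using W(1) assms by (metis card_Diff_subset card_mono finite_subset le_add_diff_inverse)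
  ultimately show ?thesis by simp
qed

text \<open>Blocks are cut by rank in \<open>C\<close>, not by length: each then holds at most
  \<open>m\<close> elements of \<open>C\<close>, and the index is defined and monotone on the whole
  real line.\<close>

definition blk :: "real set \<Rightarrow> nat \<Rightarrow> real \<Rightarrow> nat" where
  "blk C m p = card {c \<in> C. c < p} div m"

lemma blk_mono: "finite C \<Longrightarrow> p \<le> q \<Longrightarrow> blk C m p \<le> blk C m q"
  unfolding blk_def by (intro div_le_mono card_mono) auto

lemma blk_le: "finite C \<Longrightarrow> blk C m p \<le> card C div m"
  unfolding blk_def by (intro div_le_mono card_mono) auto

lemma card_blk_le:
  assumes "finite C" "m > 0"
  shows "card {c \<in> C. blk C m c = i} \<le> m"
proof -
  let ?r = "\<lambda>p. card {c \<in> C. c < p}"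
  have lt: "?r p < ?r q" if "p \<in> C" "p < q" for p q
    by (rule psubset_card_mono) (use assms that in auto)
  have "inj_on ?r {c \<in> C. blk C m c = i}"
    by (rule inj_onI) (metis (no_types, lifting) lt less_irrefl linorder_neqE mem_Collect_eq)
  then have "card {c \<in> C. blk C m c = i} = card (?r ` {c \<in> C. blk C m c = i})"
    by (simp add: card_image)
  also have "\<dots> \<le> card {i * m..<i * m + m}"
  proof (rule card_mono)
    show "?r ` {c \<in> C. blk C m c = i} \<subseteq> {i * m..<i * m + m}"
      using assms(2) dividend_less_times_div[of m] by (auto simp: blk_def ac_simps)
  qed simp
  finally show ?thesis by simp
qed

definition incidences :: "real set \<Rightarrow> real set \<Rightarrow> (real \<times> real) set \<Rightarrow> ((real \<times> real) \<times> real) set" where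
  "incidences C D L = {(l, p). l \<in> L \<and> p \<in> C \<and> fst l * p + snd l \<in> D}"

text \<open>Since \<open>s > 0\<close>, both block indices grow with \<open>p\<close>, so the cells
  met form a chain in the product order. On a chain the sum of the coordinates is injective, and it
  takes values from 0 to \<open>card C div m + card D div n\<close>.\<close>

lemma card_cells_le:
  assumes "finite C" "finite D" "s > 0"
  shows "card ((\<lambda>p. (blk C m p, blk D n (s * p + k))) ` Z) \<le> card C div m + card D div n + 1"
    (is "card (?f ` Z) \<le> _")
proof -
  have eq: "?f p = ?f q"
    if "fst (?f p) + snd (?f p) = fst (?f q) + snd (?f q)" "p \<le> q" for p q
  proof -
    have "s * p + k \<le> s * q + k" using that(2) assms(3) by simp
    then have "blk C m p \<le> blk C m q" "blk D n (s * p + k) \<le> blk D n (s * q + k)"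
      using assms that(2) by (auto intro: blk_mono)
    then show ?thesis using that(1) by simp
  qed
  have "inj_on (\<lambda>(i, j). i + j) (?f ` Z)"
    unfolding inj_on_def using eq by (smt (verit) case_prod_conv fst_conv imageE linorder_linear snd_conv)
  then have "card (?f ` Z) = card ((\<lambda>(i, j). i + j) ` ?f ` Z)" by (simp add: card_image)
  also have "\<dots> \<le> card {..card C div m + card D div n}"
    by (rule card_mono) (auto intro!: add_mono blk_le assms)
  finally show ?thesis by simp
qed

text \<open>On each line, the incidences are bounded by the cells met plus the pairs of distinct
  points sharing a cell. Two distinct points determine the line, so over all lines together these
  pairs are at most the pairs of grid points in a common cell.\<close>

lemma card_incidences_le_cells:
  assumes "finite C" "finite D" "finite L" "\<And>l. l \<in> L \<Longrightarrow> fst l > 0" "m > 0" "n > 0"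
  shows "card (incidences C D L) \<le> card L * (card C div m + card D div n + 1) + card C * card D * (m * n)"
proof -
  define Z where "Z l = {p \<in> C. fst l * p + snd l \<in> D}" for l
  define f where "f l p = (blk C m p, blk D n (fst l * p + snd l))" for l p
  define P where "P l = {(p, q). p \<in> Z l \<and> q \<in> Z l \<and> p \<noteq> q \<and> f l p = f l q}" for l
  have finZ: "finite (Z l)" for l unfolding Z_def using assms by simp
  have finP: "finite (P l)" for l
    by (rule finite_subset[of _ "Z l \<times> Z l"]) (use finZ in \<open>auto simp: P_def\<close>)
  have "incidences C D L = Sigma L Z" unfolding incidences_def Z_def by auto
  then have "card (incidences C D L) = (\<Sum>l\<in>L. card (Z l))" using assms(3) finZ by simp
  also have "\<dots> \<le> (\<Sum>l\<in>L. (card C div m + card D div n + 1) + card (P l))"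
  proof (rule sum_mono)
    fix l assume l: "l \<in> L"
    have "card (Z l) \<le> card (f l ` Z l) + card (P l)"
      unfolding P_def by (rule card_le_image_plus_collisions[OF finZ])
    moreover have "card (f l ` Z l) \<le> card C div m + card D div n + 1"
      unfolding f_def using card_cells_le assms l by blast
    ultimately show "card (Z l) \<le> (card C div m + card D div n + 1) + card (P l)" by linarith
  qed
  also have "\<dots> = card L * (card C div m + card D div n + 1) + card (Sigma L P)"
    using assms(3) finP by (simp add: sum.distrib sum_Suc algebra_simps)
  also have "card (Sigma L P) \<le> card C * card D * (m * n)"
  proof -
    define Q where "Q = Sigma (C \<times> D) (\<lambda>(c, d).
      {c' \<in> C. blk C m c' = blk C m c} \<times> {d' \<in> D. blk D n d' = blk D n d})"
    \<comment> \<open>Replaces a line with two marked abscissas by the two grid points above them;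
      distinct abscissas allow slope and intercept to be recovered.\<close>
    define h where "h = (\<lambda>((s, k), (p, q)). ((p, s * p + k), (q, s * q + k :: real)))"
    have finQ: "finite Q" unfolding Q_def using assms by auto
    have "inj_on h (Sigma L P)"
    proof (rule inj_onI, clarsimp simp: h_def P_def)
      fix s k s' k' p q :: real
      assume "s * p + k = s' * p + k'" "s * q + k = s' * q + k'" "p \<noteq> q"
      then have "(s - s') * (p - q) = 0" by (simp add: algebra_simps)
      with \<open>p \<noteq> q\<close> have "s = s'" by simp
      with \<open>s * p + k = s' * p + k'\<close> show "s = s' \<and> k = k'" by simp
    qed
    then have "card (Sigma L P) = card (h ` Sigma L P)" by (simp add: card_image)
    also have "\<dots> \<le> card Q"
      by (rule card_mono[OF finQ]) (auto simp: h_def P_def Q_def Z_def f_def)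
    also have "card Q = (\<Sum>x\<in>C \<times> D. card {c' \<in> C. blk C m c' = blk C m (fst x)}
        * card {d' \<in> D. blk D n d' = blk D n (snd x)})"
      unfolding Q_def using assms by (subst card_SigmaI) (auto simp: case_prod_unfold card_cartesian_product)
    also have "\<dots> \<le> (\<Sum>x\<in>C \<times> D. m * n)"
      by (intro sum_mono mult_le_mono card_blk_le assms)
    finally show ?thesis by (simp add: card_cartesian_product)
  qed
  finally show ?thesis by simp
qed

lemma card_incidences_le_left:
  assumes "finite C" "finite L"
  shows "card (incidences C D L) \<le> card L * card C"
proof -
  have "card (incidences C D L) \<le> card (L \<times> C)"
    by (rule card_mono) (use assms in \<open>auto simp: incidences_def\<close>)
  then show ?thesis by (simp add: card_cartesian_product)
qed

lemma card_incidences_le_right: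
  assumes "finite D" "finite L" "\<And>l. l \<in> L \<Longrightarrow> fst l > 0"
  shows "card (incidences C D L) \<le> card L * card D"
proof -
  have "inj_on (\<lambda>(l, p). (l, fst l * p + snd l)) (incidences C D L)"
    using assms(3) by (fastforce simp: inj_on_def incidences_def)
  then have "card (incidences C D L) = card ((\<lambda>(l, p). (l, fst l * p + snd l)) ` incidences C D L)"
    by (simp add: card_image)
  also have "\<dots> \<le> card (L \<times> D)"
    by (rule card_mono) (use assms in \<open>auto simp: incidences_def\<close>)
  finally show ?thesis by (simp add: card_cartesian_product)
qed

text \<open>Blocks containing a \<open>1/r\<close> fraction of each coordinate set give \<open>L r + P\<^sup>2 / r\<^sup>2\<close>;
  the optimal choice is \<open>r\<^sup>3 = P\<^sup>2 / L\<close>.\<close>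

theorem Szemeredi_Trotter_grid:
  assumes "finite C" "finite D" "finite L" "\<And>l. l \<in> L \<Longrightarrow> fst l > 0"
  shows "card (incidences C D L) \<le> 4 * card L \<or>
    real (card (incidences C D L)) ^ 3 \<le> 343 * (real (card C) * card D * card L) ^ 2"
proof (cases "C = {} \<or> D = {} \<or> L = {}")
  case True
  then have "incidences C D L = {}" unfolding incidences_def by auto
  then show ?thesis by simp
next
  case False
  define p q l N where "p = real (card C)" and "q = real (card D)" and "l = real (card L)"
    and "N = real (card (incidences C D L))"
  have pos: "p > 0" "q > 0" "l > 0"
    using False assms unfolding p_def q_def l_def by (auto simp: card_gt_0_iff)
  define r where "r = root 3 ((p * q) ^ 2 / l)"
  have r3: "r ^ 3 = (p * q) ^ 2 / l" unfolding r_def using pos by (intro odd_real_root_pow) auto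
  then have r3l: "r ^ 3 * l = (p * q) ^ 2" using pos by simp
  have rpos: "r > 0" unfolding r_def using pos by simp
  have bnd: "N \<le> l * (p / real m + q / real n + 1) + p * q * (real m * real n)" if "m > 0" "n > 0" for m n
  proof -
    have "N \<le> real (card L * (card C div m + card D div n + 1) + card C * card D * (m * n))"
      unfolding N_def using card_incidences_le_cells[OF assms that] of_nat_mono by blast
    also have "\<dots> = l * (real (card C div m) + real (card D div n) + 1) + p * q * (real m * real n)"
      unfolding p_def q_def l_def by (simp add: algebra_simps)
    also have "\<dots> \<le> l * (p / real m + q / real n + 1) + p * q * (real m * real n)"
      using pos of_nat_div_le_of_nat[of "card C" m] of_nat_div_le_of_nat[of "card D" n]
      by (intro add_mono mult_left_mono) (auto simp: p_def q_def)
    finally show ?thesis .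
  qed
  have NL: "N \<le> l * p" "N \<le> l * q"
    unfolding N_def p_def q_def l_def
    using card_incidences_le_left[of C L D] card_incidences_le_right[of D L C] assms
    by (simp_all flip: of_nat_mult)
  \<comment> \<open>7 = 3 + 4: the cells contribute \<open>3 * l * r\<close>, and the pairs
    \<open>4 * l * r\<close>, because rounding up at most doubles each of the two block sizes.
    Cubing gives 343.\<close>
  have cube: ?thesis if "N \<le> 7 * (l * r)"
  proof -
    have "N ^ 3 \<le> (7 * (l * r)) ^ 3" using that by (intro power_mono) (auto simp: N_def)
    also have "\<dots> = 343 * l ^ 2 * (r ^ 3 * l)" by (simp add: power_mult_distrib power3_eq_cube power2_eq_square)
    also have "\<dots> = 343 * (p * q * l) ^ 2" unfolding r3l by (simp add: power_mult_distrib)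
    finally show ?thesis by (simp add: N_def p_def q_def l_def)
  qed
  \<comment> \<open>The block sizes \<open>p / r\<close> and \<open>q / r\<close> make sense only in
    the last case. For \<open>r < 1\<close> the whole of each coordinate set is one block; for
    \<open>r > p\<close> or \<open>r > q\<close> it suffices that a line meets at most
    \<open>p\<close> and at most \<open>q\<close> points of the grid.\<close>
  consider "r < 1" | "r > p" | "r > q" | "1 \<le> r" "r \<le> p" "r \<le> q" by linarith
  then show ?thesis
  proof cases
    case 1
    have "N \<le> l * (p / p + q / q + 1) + p * q * (p * q)"
      using bnd[of "card C" "card D"] pos unfolding p_def q_def by simp
    also have "\<dots> = 3 * l + r ^ 3 * l" unfolding r3l using pos by (simp add: power2_eq_square)
    also have "\<dots> \<le> 3 * l + 1 * l" using 1 rpos pos by (intro add_left_mono mult_right_mono power_le_one) auto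
    finally have "N \<le> 4 * l" by simp
    then show ?thesis unfolding N_def l_def by linarith
  next
    case 2
    have "l * p \<le> l * r" "0 \<le> l * r" using 2 pos rpos by auto
    then show ?thesis using NL cube by linarith
  next
    case 3
    have "l * q \<le> l * r" "0 \<le> l * r" using 3 pos rpos by auto
    then show ?thesis using NL cube by linarith
  next
    case 4
    define m n where "m = nat \<lceil>p / r\<rceil>" and "n = nat \<lceil>q / r\<rceil>"
    have ge1: "1 \<le> p / r" "1 \<le> q / r" using 4 rpos by auto
    have m: "p / r \<le> real m" "real m \<le> 2 * (p / r)"
      unfolding m_def using ge1 by linarith+
    have n: "q / r \<le> real n" "real n \<le> 2 * (q / r)"
      unfolding n_def using ge1 by linarith+
    have mn: "real m > 0" "real n > 0" using m n ge1 by linarith+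
    have "p / real m \<le> r" "q / real n \<le> r"
      using m(1) n(1) mn rpos by (simp_all add: field_simps)
    have "real m * real n \<le> (2 * (p / r)) * (2 * (q / r))"
      using m n mn by (intro mult_mono) auto
    then have "p * q * (real m * real n) \<le> p * q * ((2 * (p / r)) * (2 * (q / r)))"
      using pos by (intro mult_left_mono) auto
    also have "\<dots> = 4 * ((p * q) ^ 2 / r ^ 2)" by (simp add: power2_eq_square)
    also have "\<dots> = 4 * (l * r)"
      unfolding r3l[symmetric] using rpos by (simp add: power2_eq_square power3_eq_cube)
    finally have 1: "p * q * (real m * real n) \<le> 4 * (l * r)" .
    have "l * (p / real m + q / real n + 1) \<le> l * (r + r + r)"
      using \<open>p / real m \<le> r\<close> \<open>q / real n \<le> r\<close> 4 pos by (intro mult_left_mono add_mono) auto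
    with 1 bnd[of m n] mn have "N \<le> l * (r + r + r) + 4 * (l * r)" by simp
    then show ?thesis by (intro cube) (simp add: algebra_simps)
  qed
qed

subsection \<open>Coincidences, representations and energies\<close>

text \<open>This is the inner product of the two functions counting fibres, a form in which
  Cauchy-Schwarz applies and in which collisions can be bounded by injections.\<close>

definition coinc :: "'a set \<Rightarrow> ('a \<Rightarrow> 'c) \<Rightarrow> 'b set \<Rightarrow> ('b \<Rightarrow> 'c) \<Rightarrow> nat" where
  "coinc T f U g = card {(p, q). p \<in> T \<and> q \<in> U \<and> f p = g q}"

lemma card_eq_sum_fibers:
  assumes "finite T" "finite Y" "f ` T \<subseteq> Y"
  shows "card T = (\<Sum>y\<in>Y. card {p \<in> T. f p = y})"
  using sum.group[OF assms, of "\<lambda>_. 1 :: nat"] by simp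

lemma coinc_eq_sum:
  assumes "finite T" "finite U" "finite Y" "f ` T \<subseteq> Y"
  shows "coinc T f U g = (\<Sum>y\<in>Y. card {p \<in> T. f p = y} * card {q \<in> U. g q = y})"
proof -
  let ?S = "{(p, q). p \<in> T \<and> q \<in> U \<and> f p = g q}"
  have fin: "finite ?S" by (rule finite_subset[of _ "T \<times> U"]) (use assms in auto)
  have "coinc T f U g = (\<Sum>y\<in>Y. card {z \<in> ?S. f (fst z) = y})"
    unfolding coinc_def using fin assms by (intro card_eq_sum_fibers) auto
  also have "\<dots> = (\<Sum>y\<in>Y. card ({p \<in> T. f p = y} \<times> {q \<in> U. g q = y}))"
    by (intro sum.cong refl arg_cong[where f = card]) auto
  finally show ?thesis by (simp add: card_cartesian_product)
qed

lemma coinc_sq_le: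
  assumes "finite T" "finite U"
  shows "real (coinc T f U g) ^ 2 \<le> real (coinc T f T f) * real (coinc U g U g)"
proof -
  let ?Y = "f ` T \<union> g ` U"
  let ?u = "\<lambda>y. real (card {p \<in> T. f p = y})" and ?v = "\<lambda>y. real (card {q \<in> U. g q = y})"
  have "real (coinc T f U g) = (\<Sum>y\<in>?Y. ?u y * ?v y)"
    using assms by (subst coinc_eq_sum[of _ _ ?Y]) auto
  moreover have "real (coinc T f T f) = (\<Sum>y\<in>?Y. (?u y)\<^sup>2)"
    using assms by (subst coinc_eq_sum[of _ _ ?Y]) (auto simp: power2_eq_square)
  moreover have "real (coinc U g U g) = (\<Sum>y\<in>?Y. (?v y)\<^sup>2)"
    using assms by (subst coinc_eq_sum[of _ _ ?Y]) (auto simp: power2_eq_square)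
  ultimately show ?thesis using Cauchy_Schwarz_ineq_sum[of ?u ?v ?Y] by simp
qed

text \<open>Cauchy-Schwarz against the identity map of \<open>Y\<close>, whose fibres are
  singletons.\<close>

lemma card_sq_le_image_coinc:
  assumes "finite T" "finite Y" "f ` T \<subseteq> Y"
  shows "real (card T) ^ 2 \<le> real (card Y) * real (coinc T f T f)"
proof -
  have "coinc T f Y (\<lambda>y. y) = card T"
    unfolding coinc_def
    by (rule bij_betw_same_card[of fst]) (use assms(3) in \<open>auto simp: bij_betw_def inj_on_def image_def\<close>)
  moreover have "coinc Y (\<lambda>y. y) Y (\<lambda>y. y) = card Y"
    unfolding coinc_def by (rule bij_betw_same_card[of fst]) (auto simp: bij_betw_def inj_on_def image_def)
  ultimately show ?thesis using coinc_sq_le[OF assms(1,2), of f "\<lambda>y. y"] by (simp add: mult.commute)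
qed

section \<open>Representation functions and additive energies\<close>

abbreviation sub :: "'a \<times> 'a \<Rightarrow> 'a :: ab_group_add" where "sub \<equiv> \<lambda>p. fst p - snd p"

definition rep :: "'a :: ab_group_add set \<Rightarrow> 'a set \<Rightarrow> 'a \<Rightarrow> nat" where
  "rep A B x = card {p \<in> A \<times> B. sub p = x}"

definition diffs :: "'a :: ab_group_add set \<Rightarrow> 'a set \<Rightarrow> 'a set" where
  "diffs A B = sub ` (A \<times> B)"

definition energy :: "nat \<Rightarrow> 'a :: ab_group_add set \<Rightarrow> 'a set \<Rightarrow> real" where
  "energy k A B = (\<Sum>x\<in>diffs A B. real (rep A B x) ^ k)"

lemma finite_diffs [simp]: "finite A \<Longrightarrow> finite B \<Longrightarrow> finite (diffs A B)"
  unfolding diffs_def by simp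

lemma diffsI: "a \<in> A \<Longrightarrow> b \<in> B \<Longrightarrow> a - b \<in> diffs A B"
  unfolding diffs_def by force

lemma rep_eq_card_right: "rep A B x = card {b \<in> B. x + b \<in> A}"
  unfolding rep_def
  by (rule bij_betw_same_card[of snd])
     (auto simp: bij_betw_def inj_on_def image_def algebra_simps)

lemma rep_eq_card_left: "rep A B x = card {a \<in> A. a - x \<in> B}"
  unfolding rep_def
  by (rule bij_betw_same_card[of fst])
     (force simp: bij_betw_def inj_on_def image_def algebra_simps)

lemma rep_le_left: "finite A \<Longrightarrow> rep A B x \<le> card A"
  unfolding rep_eq_card_left by (intro card_mono) auto

lemma rep_le_right: "finite B \<Longrightarrow> rep A B x \<le> card B"
  unfolding rep_eq_card_right by (intro card_mono) auto

lemma rep_eq_0: "x \<notin> diffs A B \<Longrightarrow> rep A B x = 0"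
  unfolding rep_def diffs_def by (metis (mono_tags, lifting) card.empty empty_Collect_eq image_eqI)

lemma rep_mono: "A \<subseteq> A' \<Longrightarrow> finite A' \<Longrightarrow> rep A B x \<le> rep A' B x"
  unfolding rep_eq_card_left by (intro card_mono) auto

lemma sum_rep_eq_card:
  assumes "finite A" "finite B" "finite Z"
  shows "(\<Sum>x\<in>Z. rep A B x) = card {p \<in> A \<times> B. sub p \<in> Z}"
proof -
  have "card {p \<in> A \<times> B. sub p \<in> Z} = (\<Sum>x\<in>Z. card {p \<in> {p \<in> A \<times> B. sub p \<in> Z}. sub p = x})"
    using assms by (intro card_eq_sum_fibers) auto
  also have "\<dots> = (\<Sum>x\<in>Z. rep A B x)"
    unfolding rep_def by (intro sum.cong refl arg_cong[where f = card]) auto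
  finally show ?thesis by simp
qed

lemma sum_rep_le:
  assumes "finite A" "finite B" "finite Z"
  shows "(\<Sum>x\<in>Z. rep A B x) \<le> card A * card B"
  unfolding sum_rep_eq_card[OF assms] card_cartesian_product[symmetric]
  using assms by (intro card_mono) auto

lemma sum_rep_diffs:
  assumes "finite A" "finite B"
  shows "(\<Sum>x\<in>diffs A B. rep A B x) = card A * card B"
proof -
  have "{p \<in> A \<times> B. sub p \<in> diffs A B} = A \<times> B" unfolding diffs_def by auto
  then show ?thesis using sum_rep_eq_card[of A B "diffs A B"] assms by (simp add: card_cartesian_product)
qed

lemma sum_rep_power_le_energy:
  assumes "finite A" "finite B" "finite Z" "k > 0"
  shows "(\<Sum>x\<in>Z. real (rep A B x) ^ k) \<le> energy k A B"
proof -
  have "(\<Sum>x\<in>Z. real (rep A B x) ^ k) = (\<Sum>x\<in>Z \<inter> diffs A B. real (rep A B x) ^ k)"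
    using assms by (intro sum.mono_neutral_right) (auto simp: rep_eq_0)
  also have "\<dots> \<le> energy k A B" unfolding energy_def using assms by (intro sum_mono2) auto
  finally show ?thesis .
qed

lemma energy_nonneg: "energy k A B \<ge> 0"
  unfolding energy_def by (intro sum_nonneg) auto

lemma energy_mono_left:
  assumes "finite A'" "finite B" "A \<subseteq> A'" "k > 0"
  shows "energy k A B \<le> energy k A' B"
proof -
  have "energy k A B \<le> (\<Sum>x\<in>diffs A B. real (rep A' B x) ^ k)"
    unfolding energy_def using assms by (intro sum_mono power_mono) (auto intro: rep_mono)
  also have "\<dots> \<le> energy k A' B"
    using assms by (intro sum_rep_power_le_energy) (auto intro!: finite_diffs intro: finite_subset)
  finally show ?thesis .
qed

lemma level_le_energy:
  assumes "finite A" "finite B" "finite Z" "k > 0"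
  shows "real t ^ k * card {x \<in> Z. t \<le> rep A B x} \<le> energy k A B"
proof -
  have "real t ^ k * card {x \<in> Z. t \<le> rep A B x} = (\<Sum>x\<in>{x \<in> Z. t \<le> rep A B x}. real t ^ k)" by simp
  also have "\<dots> \<le> (\<Sum>x\<in>{x \<in> Z. t \<le> rep A B x}. real (rep A B x) ^ k)"
    by (intro sum_mono power_mono) auto
  also have "\<dots> \<le> energy k A B" using assms by (intro sum_rep_power_le_energy) auto
  finally show ?thesis .
qed

lemma coinc_sub_eq_energy:
  assumes "finite A" "finite B"
  shows "real (coinc (A \<times> B) sub (A \<times> B) sub) = energy 2 A B"
  unfolding energy_def rep_def using assms
  by (subst coinc_eq_sum[of _ _ "diffs A B"]) (auto simp: diffs_def power2_eq_square)

lemma coinc_sub_swap_eq_energy: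
  assumes "finite A" "finite B"
  shows "real (coinc (B \<times> A) sub (B \<times> A) sub) = energy 2 A B"
proof -
  have "coinc (B \<times> A) sub (B \<times> A) sub = coinc (A \<times> B) sub (A \<times> B) sub"
    unfolding coinc_def
    by (rule bij_betw_same_card[of "\<lambda>((a, b), (c, d)). ((b, a), (d, c))"])
       (auto simp: bij_betw_def inj_on_def image_def algebra_simps)
  then show ?thesis using coinc_sub_eq_energy[OF assms] by simp
qed

text \<open>The counting form of the third energy: later, collisions of three-variable maps are
  injected into this set of triples.\<close>

lemma card_triples_eq_energy:
  assumes "finite A" "finite B"
  shows "real (card {(p, q, r). p \<in> A \<times> B \<and> q \<in> A \<times> B \<and> r \<in> A \<times> B \<and> sub p = sub q \<and> sub q = sub r})
    = energy 3 A B"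
proof -
  let ?S = "{(p, q, r). p \<in> A \<times> B \<and> q \<in> A \<times> B \<and> r \<in> A \<times> B \<and> sub p = sub q \<and> sub q = sub r}"
  let ?F = "\<lambda>x. {p \<in> A \<times> B. sub p = x}"
  have fin: "finite ?S"
    by (rule finite_subset[of _ "(A \<times> B) \<times> (A \<times> B) \<times> (A \<times> B)"]) (use assms in auto)
  have "card ?S = (\<Sum>x\<in>diffs A B. card {z \<in> ?S. sub (fst z) = x})"
    using fin assms by (intro card_eq_sum_fibers) (auto simp: diffsI)
  also have "\<dots> = (\<Sum>x\<in>diffs A B. card (?F x \<times> ?F x \<times> ?F x))"
    by (intro sum.cong refl arg_cong[where f = card]) auto
  finally show ?thesis
    unfolding energy_def rep_def by (simp add: card_cartesian_product power3_eq_cube mult.assoc)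
qed

text \<open>The square of a representation count is at most \<open>card A * card B\<close>, so
  \<open>d = card A\<close> is always admissible; taking a singleton for \<open>B\<close> shows that
  \<open>d\<close> is at least 1 when \<open>A\<close> is finite and nonempty. A small
  \<open>d\<close> means little additive structure.\<close>

definition cubic_energy_bound :: "'a :: ab_group_add set \<Rightarrow> real \<Rightarrow> bool" where
  "cubic_energy_bound A d \<longleftrightarrow>
     (\<forall>B. finite B \<longrightarrow> energy 3 A B \<le> d * real (card A) * real (card B) ^ 2)"

text \<open>Interpolation of the second moment of the representation function between the first and
  the third, by Cauchy-Schwarz with exponents 1/2 and 3/2.\<close>

lemma energy_two_sq_le:
  assumes "finite A" "finite B"
  shows "energy 2 A B ^ 2 \<le> real (card A) * real (card B) * energy 3 A B"
proof -
  let ?r = "\<lambda>x. real (rep A B x)"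
  have "(\<Sum>x\<in>diffs A B. sqrt (?r x) * (?r x * sqrt (?r x)))\<^sup>2
    \<le> (\<Sum>x\<in>diffs A B. (sqrt (?r x))\<^sup>2) * (\<Sum>x\<in>diffs A B. (?r x * sqrt (?r x))\<^sup>2)"
    by (rule Cauchy_Schwarz_ineq_sum)
  moreover have "sqrt (?r x) * (?r x * sqrt (?r x)) = ?r x ^ 2" for x
    by (simp add: power2_eq_square algebra_simps)
  moreover have "(?r x * sqrt (?r x))\<^sup>2 = ?r x ^ 3" for x
    by (simp add: power_mult_distrib power3_eq_cube power2_eq_square)
  moreover have "(\<Sum>x\<in>diffs A B. ?r x) = real (card A) * real (card B)"
    using sum_rep_diffs[OF assms] by (simp flip: of_nat_sum of_nat_mult)
  ultimately show ?thesis unfolding energy_def by simp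
qed

lemma cubic_energy_bound_energy_two:
  assumes "finite A" "finite B" "cubic_energy_bound A d"
  shows "energy 2 A B ^ 2 \<le> d * real (card A) ^ 2 * real (card B) ^ 3"
proof -
  have "energy 2 A B ^ 2 \<le> real (card A) * real (card B) * (d * real (card A) * real (card B) ^ 2)"
    using energy_two_sq_le[OF assms(1,2)] assms(2,3) unfolding cubic_energy_bound_def
    by (smt (verit) mult_left_mono mult_nonneg_nonneg of_nat_0_le_iff)
  then show ?thesis by (simp add: power2_eq_square power3_eq_cube algebra_simps)
qed

section \<open>Summation over level sets in place of dyadic pigeonholing\<close>

lemma power_le_sum_levels: "real r ^ k \<le> (\<Sum>t=1..r. real k * real t ^ (k - 1))" if k: "k > 0"
proof -
  have step: "real (Suc r) ^ k \<le> real r ^ k + real k * real (Suc r) ^ (k - 1)" for r k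
  proof (induction k)
    case (Suc k)
    have "real (Suc r) * (real (Suc r) ^ k - real r ^ k) \<le> real (Suc r) * (real k * real (Suc r) ^ (k - 1))"
      using Suc.IH by (intro mult_left_mono) auto
    also have "\<dots> = real k * real (Suc r) ^ k" by (cases k) auto
    finally have "real (Suc r) ^ Suc k \<le> real (Suc r) * real r ^ k + real k * real (Suc r) ^ k"
      by (simp add: algebra_simps)
    moreover have "real r ^ k \<le> real (Suc r) ^ k" by (intro power_mono) auto
    ultimately show ?case by (simp add: algebra_simps)
  qed simp
  show ?thesis
  proof (induction r)
    case (Suc r)
    then show ?case using step[of r k] by simp
  qed (use k in \<open>simp add: zero_power\<close>)
qed

text \<open>Layer-cake summation: level \<open>t\<close> has weight about \<open>k\<close> times
  \<open>t\<close> to the power \<open>k - 1\<close>, so the hypothesis leaves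
  \<open>k * M / t\<close>, and summing over \<open>t\<close> gives the harmonic number. Read
  backwards, a large moment forces a popular level.\<close>

lemma sum_power_le_levels:
  assumes "finite Z" "k > 0" "\<And>x. x \<in> Z \<Longrightarrow> r x \<le> n"
    and lev: "\<And>t. 1 \<le> t \<Longrightarrow> t \<le> n \<Longrightarrow> real t ^ k * card {x \<in> Z. t \<le> r x} \<le> M"
  shows "(\<Sum>x\<in>Z. real (r x) ^ k) \<le> real k * M * harm n"
proof -
  have "(\<Sum>x\<in>Z. real (r x) ^ k) \<le> (\<Sum>x\<in>Z. \<Sum>t=1..r x. real k * real t ^ (k - 1))"
    by (intro sum_mono power_le_sum_levels[OF assms(2)])
  also have "\<dots> = (\<Sum>x\<in>Z. \<Sum>t=1..n. if t \<le> r x then real k * real t ^ (k - 1) else 0)"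
  proof (rule sum.cong[OF refl])
    fix x assume "x \<in> Z"
    then have "{1..r x} = {t \<in> {1..n}. t \<le> r x}" using assms(3)[of x] by auto
    then show "(\<Sum>t=1..r x. real k * real t ^ (k - 1))
      = (\<Sum>t=1..n. if t \<le> r x then real k * real t ^ (k - 1) else 0)"
      by (simp only: sum.inter_filter[OF finite_atLeastAtMost])
  qed
  also have "\<dots> = (\<Sum>t=1..n. \<Sum>x\<in>Z. if t \<le> r x then real k * real t ^ (k - 1) else 0)"
    by (rule sum.swap)
  also have "\<dots> = (\<Sum>t=1..n. real k * (real t ^ (k - 1) * card {x \<in> Z. t \<le> r x}))"
    using assms(1) by (intro sum.cong refl) (simp flip: sum.inter_filter)
  also have "\<dots> \<le> (\<Sum>t=1..n. real k * (M * inverse (real t)))"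
  proof (intro sum_mono mult_left_mono)
    fix t assume t: "t \<in> {1..n}"
    have "real t ^ (k - 1) * card {x \<in> Z. t \<le> r x} = real t ^ k * card {x \<in> Z. t \<le> r x} * inverse (real t)"
      using t assms(2) by (cases k) auto
    also have "\<dots> \<le> M * inverse (real t)" using t lev[of t] by (intro mult_right_mono) auto
    finally show "real t ^ (k - 1) * card {x \<in> Z. t \<le> r x} \<le> M * inverse (real t)" .
  qed auto
  also have "\<dots> = real k * M * harm n" unfolding harm_def by (simp add: sum_distrib_left mult.assoc)
  finally show ?thesis .
qed

text \<open>In decreasing order, the \<open>j\<close>-th largest weight is at most
  \<open>M / j\<close>. The induction removes a smallest weight, whose level set is all of
  \<open>X\<close>. Read backwards, it finds a threshold at which few elements carry a fair share of
  the sum.\<close>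

lemma sum_le_popular:
  fixes w :: "'a \<Rightarrow> real"
  assumes "finite X" "\<And>a. a \<in> X \<Longrightarrow> 0 \<le> w a"
    and "\<And>a. a \<in> X \<Longrightarrow> w a * card {b \<in> X. w a \<le> w b} \<le> M"
  shows "sum w X \<le> M * harm (card X)"
  using assms
proof (induction "card X" arbitrary: X)
  case 0
  then show ?case by (simp add: harm_def)
next
  case (Suc n)
  then have ne: "w ` X \<noteq> {}" "finite (w ` X)" by auto
  obtain a where a: "a \<in> X" "w a = Min (w ` X)" using Min_in[OF ne(2,1)] by auto
  have min: "w a \<le> w b" if "b \<in> X" for b unfolding a(2) using that ne by simp
  have n: "n = card (X - {a})" using Suc a by simp
  have "w b * card {c \<in> X - {a}. w b \<le> w c} \<le> M" if b: "b \<in> X - {a}" for b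
  proof -
    have "card {c \<in> X - {a}. w b \<le> w c} \<le> card {c \<in> X. w b \<le> w c}"
      using Suc.prems(1) by (intro card_mono) auto
    then have "w b * card {c \<in> X - {a}. w b \<le> w c} \<le> w b * card {c \<in> X. w b \<le> w c}"
      using Suc.prems(2) b by (intro mult_left_mono) auto
    then show ?thesis using Suc.prems(3)[of b] b by auto
  qed
  with Suc have "sum w (X - {a}) \<le> M * harm n" using Suc.hyps(1)[OF n] n by simp
  moreover have "{b \<in> X. w a \<le> w b} = X" using min by auto
  then have "w a * real (Suc n) \<le> M" using Suc.prems(3)[OF a(1)] Suc.hyps(2) by simp
  then have "w a \<le> M * inverse (real (Suc n))" by (simp add: field_simps)
  moreover have "sum w X = w a + sum w (X - {a})" using a Suc.prems(1) by (simp add: sum.remove)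
  ultimately show ?case
    unfolding Suc.hyps(2)[symmetric] harm_Suc by (simp add: algebra_simps)
qed

subsection \<open>Differences and sums\<close>

lemma cubic_energy_bound_nonneg:
  assumes "finite A" "A \<noteq> {}" "cubic_energy_bound A d"
  shows "d \<ge> 0"
proof -
  have "0 \<le> d * real (card A) * real (card A) ^ 2"
    using assms energy_nonneg[of 3 A A] unfolding cubic_energy_bound_def by (meson order_trans)
  then have "0 \<le> d * real (card A) ^ 3" by (simp add: power2_eq_square power3_eq_cube mult.assoc)
  moreover have "real (card A) ^ 3 > 0" using assms by (simp add: card_gt_0_iff)
  ultimately show ?thesis by (simp add: zero_le_mult_iff)
qed

text \<open>Write \<open>A\<^sub>s = A \<inter> (A - s)\<close>. The inclusion \<open>A - A\<^sub>s \<subseteq> D \<inter> (D + s)\<close> for \<open>D = A - A\<close> (Katz and Koester)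
  turns the coincidences of \<open>(s, a, b) \<mapsto> (s, a - b)\<close>, controlled by the third energy, into a lower
  bound for the number of pairs in \<open>D\<close> with a popular difference.\<close>

theorem card_le_card_diffs:
  fixes A :: "'a :: ab_group_add set"
  assumes "finite A" "A \<noteq> {}" "cubic_energy_bound A d"
  shows "real (card A) ^ 8 \<le> 64 * d ^ 3 * real (card (diffs A A)) ^ 5"
proof -
  define D where "D = diffs A A"
  define n m where "n = real (card A)" and "m = real (card D)"
  \<comment> \<open>The average of \<open>rep A A\<close> on \<open>D\<close> is
    \<open>n^2 / m\<close>; differences below half of it account for at most half of all
    pairs.\<close>
  define P where "P = {s \<in> D. n\<^sup>2 \<le> 2 * m * real (rep A A s)}"
  have D: "finite D" "D \<noteq> {}" unfolding D_def using assms by (auto simp: diffs_def)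
  then have P: "finite P" "P \<subseteq> D" unfolding P_def by auto
  have pos: "n > 0" "m > 0" unfolding n_def m_def using assms D by (auto simp: card_gt_0_iff)
  have d0: "d \<ge> 0" using cubic_energy_bound_nonneg[OF assms] .
  have popular: "(\<Sum>s\<in>P. real (rep A A s)) \<ge> n\<^sup>2 / 2"
  proof -
    have "(\<Sum>s\<in>D - P. real (rep A A s)) \<le> (\<Sum>s\<in>D - P. n\<^sup>2 / (2 * m))"
      by (intro sum_mono) (use pos in \<open>auto simp: P_def field_simps\<close>)
    also have "\<dots> \<le> (\<Sum>s\<in>D. n\<^sup>2 / (2 * m))" using D pos by (intro sum_mono2) auto
    also have "\<dots> = n\<^sup>2 / 2" using pos by (simp add: m_def)
    finally have "(\<Sum>s\<in>D - P. real (rep A A s)) \<le> n\<^sup>2 / 2" .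
    moreover have "(\<Sum>s\<in>D. real (rep A A s)) = n\<^sup>2"
      using sum_rep_diffs[OF assms(1,1)] unfolding D_def n_def
      by (simp add: power2_eq_square flip: of_nat_sum of_nat_mult)
    moreover have "(\<Sum>s\<in>D. real (rep A A s)) = (\<Sum>s\<in>P. real (rep A A s)) + (\<Sum>s\<in>D - P. real (rep A A s))"
      using D P by (metis add.commute sum.subset_diff)
    ultimately show ?thesis by linarith
  qed
  define T where "T = Sigma P (\<lambda>s. A \<times> {b \<in> A. s + b \<in> A})"
  define f where "f = (\<lambda>(s :: 'a, a, b). (s, a - b :: 'a))"
  define W where "W = {(s, y). s \<in> P \<and> y \<in> D \<and> y - s \<in> D}"
  have finT: "finite T" unfolding T_def using P assms by auto
  have finW: "finite W" by (rule finite_subset[of _ "P \<times> D"]) (use P D in \<open>auto simp: W_def\<close>)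
  have "real (card T) = n * (\<Sum>s\<in>P. real (rep A A s))"
    unfolding T_def n_def rep_eq_card_right using P assms
    by (subst card_SigmaI) (auto simp: card_cartesian_product sum_distrib_left)
  also have "\<dots> \<ge> n * (n\<^sup>2 / 2)" using popular pos by (intro mult_left_mono) auto
  finally have "n ^ 3 / 2 \<le> real (card T)" by (simp add: power2_eq_square power3_eq_cube)
  then have "(n ^ 3 / 2)\<^sup>2 \<le> real (card T) ^ 2" using pos by (intro power_mono) auto
  also have "\<dots> \<le> real (card W) * real (coinc T f T f)"
  proof (rule card_sq_le_image_coinc[OF finT finW])
    have "a - b - s \<in> D" if "a \<in> A" "s + b \<in> A" for a b s
      using diffsI[OF that] by (simp add: D_def algebra_simps)
    then show "f ` T \<subseteq> W" unfolding f_def T_def W_def by (auto simp: D_def diffsI)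
  qed
  \<comment> \<open>A collision has \<open>s = s'\<close> and \<open>a - b = a' - b'\<close>, so
    \<open>(a, a')\<close>, \<open>(b, b')\<close> and \<open>(s + b, s' + b')\<close> have the same
    difference.\<close>
  also have "real (coinc T f T f) \<le> energy 3 A A"
  proof -
    let ?S = "{(p, q, r). p \<in> A \<times> A \<and> q \<in> A \<times> A \<and> r \<in> A \<times> A \<and> sub p = sub q \<and> sub q = sub r}"
    have "finite ?S"
      by (rule finite_subset[of _ "(A \<times> A) \<times> (A \<times> A) \<times> (A \<times> A)"]) (use assms in auto)
    then have "coinc T f T f \<le> card ?S"
      unfolding coinc_def
      by (intro card_inj_on_le[of "\<lambda>((s, a, b), (s', a', b')). ((a, a'), (b, b'), (s + b, s' + b'))"])
         (auto simp: T_def f_def inj_on_def algebra_simps)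
    then show ?thesis using card_triples_eq_energy[OF assms(1,1)] by simp
  qed
  also have "energy 3 A A \<le> d * n ^ 3"
    using assms unfolding cubic_energy_bound_def n_def
    by (auto simp: power2_eq_square power3_eq_cube mult.assoc)
  finally have "(n ^ 3 / 2)\<^sup>2 \<le> real (card W) * (d * n ^ 3)" by (simp add: mult_left_mono)
  then have "n ^ 3 * n ^ 3 \<le> (4 * real (card W) * d) * n ^ 3"
    by (simp add: power2_eq_square algebra_simps)
  then have 1: "n ^ 3 \<le> 4 * real (card W) * d" by (rule mult_right_le_imp_le) (use pos in simp)
  \<comment> \<open>Every way of writing a popular \<open>s\<close> as \<open>(s + b) - b\<close>
    turns \<open>(s, y)\<close> in \<open>W\<close> into a solution of
    \<open>(s + b) - y = b - (y - s)\<close>, and such solutions are counted by the second energy of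
    \<open>A\<close> and \<open>D\<close>.\<close>
  have 2: "real (card W) * n\<^sup>2 \<le> 2 * m * energy 2 A D"
  proof -
    define U where "U = Sigma W (\<lambda>x. {b \<in> A. fst x + b \<in> A})"
    have "real (card W) * n\<^sup>2 = (\<Sum>x\<in>W. n\<^sup>2)" by simp
    also have "\<dots> \<le> (\<Sum>x\<in>W. 2 * m * real (rep A A (fst x)))"
      by (intro sum_mono) (auto simp: W_def P_def)
    also have "\<dots> = 2 * m * real (card U)"
      unfolding U_def rep_eq_card_right using finW assms
      by (subst card_SigmaI) (auto simp: sum_distrib_left)
    also have "card U \<le> coinc (A \<times> D) sub (A \<times> D) sub"
      unfolding coinc_def
    proof (rule card_inj_on_le[of "\<lambda>((s, y), b). ((s + b, y), (b, y - s))"])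
      show "finite {(p, q). p \<in> A \<times> D \<and> q \<in> A \<times> D \<and> sub p = sub q}"
        by (rule finite_subset[of _ "(A \<times> D) \<times> (A \<times> D)"]) (use assms D in auto)
    qed (auto simp: U_def W_def inj_on_def algebra_simps)
    finally show ?thesis using pos coinc_sub_eq_energy[OF assms(1) D(1)] by (simp add: mult_left_mono)
  qed
  have "n ^ 5 = n ^ 3 * n\<^sup>2" by (simp add: power_add[symmetric])
  also have "\<dots> \<le> 4 * real (card W) * d * n\<^sup>2" using 1 by (intro mult_right_mono) auto
  also have "\<dots> = 4 * d * (real (card W) * n\<^sup>2)" by simp
  also have "\<dots> \<le> 4 * d * (2 * m * energy 2 A D)" using 2 d0 by (intro mult_left_mono) auto
  finally have "(n ^ 5)\<^sup>2 \<le> (4 * d * (2 * m * energy 2 A D))\<^sup>2" using pos by (intro power_mono) auto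
  also have "\<dots> = 64 * d\<^sup>2 * m\<^sup>2 * (energy 2 A D)\<^sup>2" by (simp add: power_mult_distrib)
  also have "\<dots> \<le> 64 * d\<^sup>2 * m\<^sup>2 * (d * n\<^sup>2 * m ^ 3)"
    using cubic_energy_bound_energy_two[OF assms(1) D(1) assms(3)] unfolding n_def m_def
    by (intro mult_left_mono) auto
  finally have "n ^ 8 * n\<^sup>2 \<le> 64 * d ^ 3 * m ^ 5 * n\<^sup>2"
    by (simp add: power2_eq_square eval_nat_numeral algebra_simps)
  then have "n ^ 8 \<le> 64 * d ^ 3 * m ^ 5" by (rule mult_right_le_imp_le) (use pos in simp)
  then show ?thesis unfolding n_def m_def D_def .
qed

section \<open>Sumsets, through popular sums\<close>

abbreviation add :: "'a \<times> 'a \<Rightarrow> 'a :: ab_group_add" where "add \<equiv> \<lambda>p. fst p + snd p"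

definition sumset :: "'a :: ab_group_add set \<Rightarrow> 'a set \<Rightarrow> 'a set" where
  "sumset A B = add ` (A \<times> B)"

lemma finite_sumset [simp]: "finite A \<Longrightarrow> finite B \<Longrightarrow> finite (sumset A B)"
  unfolding sumset_def by simp

text \<open>Sums with fewer than a quarter of the average number of representations use up at most a
  quarter of all pairs. Each \<open>x\<close> outside \<open>A'\<close> lies in at least
  \<open>n / 2\<close> such pairs, so at most half of \<open>A\<close> is lost. The gain is that
  every row of the matrix of popular sums indexed by \<open>A'\<close> is at least half
  full.\<close>

lemma popular_sums:
  fixes A :: "'a :: ab_group_add set"
  assumes "finite A" "A \<noteq> {}"
  obtains S' A' where "S' \<subseteq> sumset A A" "A' \<subseteq> A" "card A \<le> 2 * card A'"
    "\<And>x. x \<in> S' \<Longrightarrow> (card A)\<^sup>2 \<le> 4 * card (sumset A A) * card {p \<in> A \<times> A. add p = x}"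
    "\<And>x. x \<in> A' \<Longrightarrow> card A \<le> 2 * card {y \<in> A. x + y \<in> S'}"
proof -
  define n s where "n = card A" and "s = card (sumset A A)"
  define S' where "S' = {x \<in> sumset A A. n\<^sup>2 \<le> 4 * s * card {p \<in> A \<times> A. add p = x}}"
  define A' where "A' = {x \<in> A. n \<le> 2 * card {y \<in> A. x + y \<in> S'}}"
  define bad where "bad = {p \<in> A \<times> A. add p \<in> sumset A A - S'}"
  have fins: "finite (sumset A A)" using assms by simp
  have n: "n > 0" unfolding n_def using assms by (simp add: card_gt_0_iff)
  have "card bad = (\<Sum>x\<in>sumset A A - S'. card {p \<in> bad. add p = x})"
    using assms by (intro card_eq_sum_fibers) (auto simp: bad_def)
  also have "\<dots> = (\<Sum>x\<in>sumset A A - S'. card {p \<in> A \<times> A. add p = x})"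
    by (intro sum.cong refl arg_cong[where f = card]) (auto simp: bad_def)
  finally have "4 * s * card bad = (\<Sum>x\<in>sumset A A - S'. 4 * s * card {p \<in> A \<times> A. add p = x})"
    by (simp add: sum_distrib_left)
  also have "\<dots> \<le> (\<Sum>x\<in>sumset A A - S'. n\<^sup>2)" by (intro sum_mono) (auto simp: S'_def)
  also have "\<dots> \<le> (\<Sum>x\<in>sumset A A. n\<^sup>2)" using fins by (intro sum_mono2) auto
  also have "\<dots> = s * n\<^sup>2" by (simp add: s_def)
  finally have "s * (4 * card bad) \<le> s * n\<^sup>2" by simp
  moreover have "s > 0" unfolding s_def using fins assms by (auto simp: card_gt_0_iff sumset_def)
  ultimately have bad: "4 * card bad \<le> n\<^sup>2" by simp
  have "n * card (A - A') = (\<Sum>x\<in>A - A'. n)" by simp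
  also have "\<dots> \<le> (\<Sum>x\<in>A - A'. 2 * card {y \<in> A. x + y \<notin> S'})"
  proof (rule sum_mono)
    fix x assume x: "x \<in> A - A'"
    have "card {y \<in> A. x + y \<in> S'} + card {y \<in> A. x + y \<notin> S'} = card ({y \<in> A. x + y \<in> S'} \<union> {y \<in> A. x + y \<notin> S'})"
      using assms by (intro card_Un_disjoint[symmetric]) auto
    also have "{y \<in> A. x + y \<in> S'} \<union> {y \<in> A. x + y \<notin> S'} = A" by auto
    finally show "n \<le> 2 * card {y \<in> A. x + y \<notin> S'}" using x by (auto simp: A'_def n_def)
  qed
  also have "\<dots> = 2 * card (Sigma (A - A') (\<lambda>x. {y \<in> A. x + y \<notin> S'}))"
    using assms by (subst card_SigmaI) (auto simp: sum_distrib_left)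
  also have "card (Sigma (A - A') (\<lambda>x. {y \<in> A. x + y \<notin> S'})) \<le> card bad"
    by (rule card_mono) (use assms in \<open>auto simp: bad_def sumset_def\<close>)
  finally have "n * card (A - A') \<le> 2 * card bad" by simp
  then have "n * (2 * card (A - A')) \<le> n * n" using bad unfolding power2_eq_square by linarith
  then have "2 * card (A - A') \<le> n" using n by simp
  moreover have "card (A - A') = n - card A'" "card A' \<le> n"
    unfolding n_def using assms by (auto simp: A'_def card_Diff_subset card_mono)
  ultimately have "n \<le> 2 * card A'" by linarith
  then show ?thesis
    by (intro that[of S' A']) (auto simp: S'_def A'_def n_def s_def)
qed

text \<open>The coincidences of \<open>(x, x', y) \<mapsto> (x - x', y)\<close> stand in for the trace of \<open>T\<^sup>t R T\<close>, where \<open>T\<close> is the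
  matrix of popular sums and \<open>R\<close> the representation matrix of differences in \<open>A'\<close>; Cauchy-Schwarz
  separately for each \<open>w = x - x'\<close> replaces the eigenvalue bound.\<close>

lemma coinc_lower:
  fixes A A' :: "'a :: ab_group_add set"
  assumes "finite A" "finite A'"
    and pop: "\<And>x. x \<in> A' \<Longrightarrow> card A \<le> 2 * card {y \<in> A. x + y \<in> S'}"
  defines "T \<equiv> {(x, x', y). x \<in> A' \<and> x' \<in> A' \<and> y \<in> A \<and> x + y \<in> S'}"
    and "f \<equiv> \<lambda>(x, x', y). (x - x', y)"
  shows "real (card A) * energy 2 A' A' \<le> 4 * real (coinc T f T f)"
proof (cases "A = {}")
  case False
  define n where "n = real (card A)"
  have n: "n > 0" unfolding n_def using assms False by (simp add: card_gt_0_iff)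
  define W where "W = diffs A' A'"
  define c where "c w y = real (card {p \<in> T. f p = (w, y)})" for w y
  have finT: "finite T" by (rule finite_subset[of _ "A' \<times> A' \<times> A"]) (use assms in \<open>auto simp: T_def\<close>)
  have "coinc T f T f = (\<Sum>z\<in>W \<times> A. card {p \<in> T. f p = z} * card {p \<in> T. f p = z})"
    using finT assms by (intro coinc_eq_sum) (auto simp: W_def T_def f_def diffsI)
  then have Tr: "real (coinc T f T f) = (\<Sum>w\<in>W. \<Sum>y\<in>A. c w y ^ 2)"
    unfolding c_def sum.cartesian_product by (simp add: power2_eq_square case_prod_unfold)
  have "n ^ 2 * real (rep A' A' w) ^ 2 \<le> 4 * (n * (\<Sum>y\<in>A. c w y ^ 2))" for w
  proof -
    let ?F = "{p \<in> A' \<times> A'. sub p = w}"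
    let ?G = "Sigma ?F (\<lambda>p. {y \<in> A. fst p + y \<in> S'})"
    have "(\<Sum>y\<in>A. c w y) = real (\<Sum>y\<in>A. card {p \<in> {p \<in> T. fst (f p) = w}. snd (f p) = y})"
      unfolding c_def of_nat_sum by (intro sum.cong refl arg_cong[where f = "\<lambda>x. real (card x)"]) auto
    also have "\<dots> = real (card {p \<in> T. fst (f p) = w})"
      using finT assms by (subst card_eq_sum_fibers[where Y = A and f = "\<lambda>p. snd (f p)"]) (auto simp: T_def f_def)
    also have "card {p \<in> T. fst (f p) = w} = card ?G"
      by (rule bij_betw_same_card[of "\<lambda>(x, x', y). ((x, x'), y)"])
         (force simp: bij_betw_def inj_on_def T_def f_def image_def)
    also have "card ?G = (\<Sum>p\<in>?F. card {y \<in> A. fst p + y \<in> S'})"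
      using assms by (intro card_SigmaI) auto
    finally have "2 * (\<Sum>y\<in>A. c w y) = (\<Sum>p\<in>?F. 2 * real (card {y \<in> A. fst p + y \<in> S'}))"
      by (simp add: sum_distrib_left)
    also have "\<dots> \<ge> (\<Sum>p\<in>?F. n)"
    proof (rule sum_mono)
      fix p assume "p \<in> ?F"
      then have "card A \<le> 2 * card {y \<in> A. fst p + y \<in> S'}" using pop[of "fst p"] by auto
      then show "n \<le> 2 * real (card {y \<in> A. fst p + y \<in> S'})" unfolding n_def by linarith
    qed
    finally have "n * real (rep A' A' w) \<le> 2 * (\<Sum>y\<in>A. c w y)"
      by (simp add: rep_def mult.commute)
    then have "(n * real (rep A' A' w))\<^sup>2 \<le> (2 * (\<Sum>y\<in>A. c w y))\<^sup>2"
      using n by (intro power_mono) auto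
    also have "\<dots> = 4 * (\<Sum>y\<in>A. 1 * c w y)\<^sup>2" by (simp add: power_mult_distrib)
    also have "\<dots> \<le> 4 * (n * (\<Sum>y\<in>A. c w y ^ 2))"
      using Cauchy_Schwarz_ineq_sum[of "\<lambda>_. 1" "c w" A] by (simp add: n_def)
    finally show ?thesis by (simp add: power_mult_distrib)
  qed
  then have "(\<Sum>w\<in>W. n ^ 2 * real (rep A' A' w) ^ 2) \<le> (\<Sum>w\<in>W. 4 * (n * (\<Sum>y\<in>A. c w y ^ 2)))"
    by (intro sum_mono)
  then have "n * (n * energy 2 A' A') \<le> n * (4 * real (coinc T f T f))"
    unfolding energy_def Tr W_def by (simp add: sum_distrib_left power2_eq_square mult_ac)
  then show ?thesis using n by (simp add: n_def)
qed simp

text \<open>A collision of \<open>(x, x', y)\<close> and \<open>(z, z', y)\<close> satisfies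
  \<open>x - z = x' - z'\<close>, and this is also the difference of the two points
  \<open>x + y\<close> and \<open>z + y\<close> of \<open>S'\<close>. Grouping by these points,
  Cauchy-Schwarz separates the number of choices of \<open>(x, y, z)\<close> from that of
  \<open>(x', z')\<close>. Two choices of \<open>(x, y, z)\<close> with the same points again yield
  three pairs with a common difference, hence the third energy.\<close>

lemma coinc_upper:
  fixes A A' :: "'a :: ab_group_add set"
  assumes "finite A" "A' \<subseteq> A" "finite S'"
  defines "T \<equiv> {(x, x', y). x \<in> A' \<and> x' \<in> A' \<and> y \<in> A \<and> x + y \<in> S'}"
    and "f \<equiv> \<lambda>(x, x', y). (x - x', y)"
  shows "real (coinc T f T f) ^ 2 \<le> energy 3 A A * (\<Sum>z\<in>S' \<times> S'. real (rep A' A' (sub z)) ^ 2)"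
proof -
  define V where "V = A \<times> A \<times> A"
  define g where "g = (\<lambda>(x, y, z). (x + y, z + y :: 'a))"
  define V' where "V' = {p \<in> V. g p \<in> S' \<times> S'}"
  define c where "c z = card {p \<in> V'. g p = z}" for z
  have finA': "finite A'" using assms finite_subset by blast
  have finV: "finite V" "finite V'" unfolding V_def V'_def using assms by auto
  have "coinc T f T f \<le> card (SIGMA z : S' \<times> S'. {p \<in> V'. g p = z} \<times> {p \<in> A' \<times> A'. sub p = sub z})"
    unfolding coinc_def
  proof (rule card_inj_on_le[of "\<lambda>((x, x', y), (z, z', y')). ((x + y, z + y), ((x, y, z), (x', z')))"])
    show "finite (SIGMA z : S' \<times> S'. {p \<in> V'. g p = z} \<times> {p \<in> A' \<times> A'. sub p = sub z})"
      using assms finV finA' by (intro finite_SigmaI finite_cartesian_product) auto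
  qed (use assms(2) in \<open>auto simp: T_def f_def V'_def V_def g_def inj_on_def algebra_simps\<close>)
  also have "\<dots> = (\<Sum>z\<in>S' \<times> S'. c z * rep A' A' (sub z))"
    unfolding c_def rep_def using assms finV finA'
    by (subst card_SigmaI) (auto simp: card_cartesian_product)
  finally have "real (coinc T f T f) \<le> (\<Sum>z\<in>S' \<times> S'. real (c z) * real (rep A' A' (sub z)))"
    by (simp flip: of_nat_mult of_nat_sum)
  then have "real (coinc T f T f) ^ 2 \<le> (\<Sum>z\<in>S' \<times> S'. real (c z) * real (rep A' A' (sub z)))\<^sup>2"
    by (intro power_mono) auto
  also have "\<dots> \<le> (\<Sum>z\<in>S' \<times> S'. real (c z) ^ 2) * (\<Sum>z\<in>S' \<times> S'. real (rep A' A' (sub z)) ^ 2)"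
    by (rule Cauchy_Schwarz_ineq_sum)
  also have "(\<Sum>z\<in>S' \<times> S'. real (c z) ^ 2) = real (coinc V' g V' g)"
    unfolding c_def using finV assms
    by (subst coinc_eq_sum[of _ _ "S' \<times> S'"]) (auto simp: V'_def power2_eq_square)
  also have "real (coinc V' g V' g) \<le> energy 3 A A"
  proof -
    let ?S = "{(p, q, r). p \<in> A \<times> A \<and> q \<in> A \<times> A \<and> r \<in> A \<times> A \<and> sub p = sub q \<and> sub q = sub r}"
    have "finite ?S"
      by (rule finite_subset[of _ "(A \<times> A) \<times> (A \<times> A) \<times> (A \<times> A)"]) (use assms in auto)
    then have "coinc V' g V' g \<le> card ?S"
      unfolding coinc_def
      by (intro card_inj_on_le[of "\<lambda>((x, y, z), (x2, y2, z2)). ((x2, x), (y, y2), (z2, z))"])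
         (auto simp: V'_def V_def g_def inj_on_def algebra_simps)
    then show ?thesis using card_triples_eq_energy[OF assms(1,1)] by simp
  qed
  finally show ?thesis by (simp add: mult_right_mono sum_nonneg)
qed

text \<open>For a level \<open>t\<close>, let \<open>P\<close> be the differences with at least
  \<open>t\<close> representations in \<open>A'\<close>. If \<open>x - y\<close> lies in
  \<open>P\<close> and \<open>x = a + b\<close> is one of the many representations of a popular sum,
  then \<open>a - y = (x - y) - b\<close>. Such equations are bounded by the second energies of
  \<open>A\<close> with the sumset and of \<open>A\<close> with \<open>P\<close>, to both of which
  the cubic bound applies.\<close>

lemma sum_rep_sq_popular_sums:
  fixes A A' :: "'a :: ab_group_add set"
  assumes A: "finite A" "A \<noteq> {}" and bound: "cubic_energy_bound A d" and A': "A' \<subseteq> A" and S': "S' \<subseteq> sumset A A"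
    and pop: "\<And>x. x \<in> S' \<Longrightarrow> (card A)\<^sup>2 \<le> 4 * card (sumset A A) * card {p \<in> A \<times> A. add p = x}"
  shows "(\<Sum>z\<in>S' \<times> S'. real (rep A' A' (sub z)) ^ 2) ^ 4
    \<le> 4096 * harm (card A) ^ 4 * real (card (sumset A A)) ^ 7 * d ^ 4 * real (card A) ^ 2 * energy 2 A' A'"
proof -
  define n S s E where "n = real (card A)" and "S = sumset A A" and "s = real (card S)" and "E = energy 2 A' A'"
  have n: "n > 0" unfolding n_def using A by (simp add: card_gt_0_iff)
  have d0: "d \<ge> 0" using cubic_energy_bound_nonneg A bound by blast
  have fin: "finite S" "finite S'" "finite A'" using A A' S' unfolding S_def by (auto intro: finite_subset)
  have E: "E \<ge> 0" unfolding E_def by (rule energy_nonneg)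
  \<comment> \<open>Chosen so that the estimate for every level reads \<open>t^2 * g <= M\<close>,
    whatever \<open>t\<close> is.\<close>
  define M where "M = root 4 (256 * s ^ 7 * d ^ 4 * n\<^sup>2 * E)"
  have M: "M \<ge> 0" "M ^ 4 = 256 * s ^ 7 * d ^ 4 * n\<^sup>2 * E"
    unfolding M_def using E d0 by (auto simp: s_def)
  have "real t ^ 2 * card {z \<in> S' \<times> S'. t \<le> rep A' A' (sub z)} \<le> M" if t: "1 \<le> t" for t
  proof -
    define P where "P = {x \<in> diffs A' A'. t \<le> rep A' A' x}"
    define G where "G = {z \<in> S' \<times> S'. t \<le> rep A' A' (sub z)}"
    have finP: "finite P" "finite G" unfolding P_def G_def using fin by auto
    define p g where "p = real (card P)" and "g = real (card G)"
    have sub_P: "sub z \<in> P" if "z \<in> G" for z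
      using that t rep_eq_0[of "sub z" A' A'] unfolding G_def P_def by force
    have "n\<^sup>2 * g = (\<Sum>z\<in>G. n\<^sup>2)" unfolding g_def by simp
    also have "\<dots> \<le> (\<Sum>z\<in>G. 4 * s * real (card {q \<in> A \<times> A. add q = fst z}))"
    proof (rule sum_mono)
      fix z assume "z \<in> G"
      then have "(card A)\<^sup>2 \<le> 4 * card S * card {q \<in> A \<times> A. add q = fst z}"
        using pop[of "fst z"] unfolding G_def S_def by auto
      then have "real ((card A)\<^sup>2) \<le> real (4 * card S * card {q \<in> A \<times> A. add q = fst z})"
        by (rule of_nat_mono)
      then show "n\<^sup>2 \<le> 4 * s * real (card {q \<in> A \<times> A. add q = fst z})"
        by (simp add: n_def s_def)
    qed
    also have "\<dots> = 4 * s * real (card (SIGMA z : G. {q \<in> A \<times> A. add q = fst z}))"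
      using finP A by (subst card_SigmaI) (auto simp: sum_distrib_left)
    also have "card (SIGMA z : G. {q \<in> A \<times> A. add q = fst z}) \<le> coinc (A \<times> S) sub (P \<times> A) sub"
      unfolding coinc_def
    proof (rule card_inj_on_le[of "\<lambda>((x, y), (a, b)). ((a, y), (x - y, b))"])
      show "finite {(p, q). p \<in> A \<times> S \<and> q \<in> P \<times> A \<and> sub p = sub q}"
        by (rule finite_subset[of _ "(A \<times> S) \<times> (P \<times> A)"]) (use A fin finP in auto)
      show "(\<lambda>((x, y), (a, b)). ((a, y), (x - y, b))) ` (SIGMA z : G. {q \<in> A \<times> A. add q = fst z})
        \<subseteq> {(p, q). p \<in> A \<times> S \<and> q \<in> P \<times> A \<and> sub p = sub q}"
        using sub_P S' by (force simp: G_def S_def)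
    qed (auto simp: inj_on_def)
    finally have "n\<^sup>2 * g \<le> 4 * s * real (coinc (A \<times> S) sub (P \<times> A) sub)"
      by (simp add: s_def mult_left_mono)
    then have "(n\<^sup>2 * g)\<^sup>2 \<le> (4 * s * real (coinc (A \<times> S) sub (P \<times> A) sub))\<^sup>2"
      by (intro power_mono) (auto simp: g_def)
    also have "\<dots> = 16 * s\<^sup>2 * (real (coinc (A \<times> S) sub (P \<times> A) sub))\<^sup>2" by (simp add: power_mult_distrib)
    also have "\<dots> \<le> 16 * s\<^sup>2 * (energy 2 A S * energy 2 A P)"
      using coinc_sq_le[of "A \<times> S" "P \<times> A" sub sub] coinc_sub_eq_energy[of A S] coinc_sub_swap_eq_energy[of A P]
        A fin finP by (intro mult_left_mono) auto
    finally have "((n\<^sup>2 * g)\<^sup>2)\<^sup>2 \<le> (16 * s\<^sup>2 * (energy 2 A S * energy 2 A P))\<^sup>2"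
      by (intro power_mono) auto
    also have "\<dots> = 256 * s ^ 4 * (energy 2 A S ^ 2 * energy 2 A P ^ 2)" by (simp add: power_mult_distrib)
    also have "\<dots> \<le> 256 * s ^ 4 * ((d * n\<^sup>2 * s ^ 3) * (d * n\<^sup>2 * p ^ 3))"
      unfolding n_def s_def p_def using A fin finP bound d0
      by (intro mult_left_mono mult_mono cubic_energy_bound_energy_two) auto
    also have "\<dots> = 256 * s ^ 7 * d\<^sup>2 * n ^ 4 * p ^ 3" by algebra
    also have "((n\<^sup>2 * g)\<^sup>2)\<^sup>2 = n ^ 8 * g ^ 4" by algebra
    finally have 1: "n ^ 8 * g ^ 4 \<le> 256 * s ^ 7 * d\<^sup>2 * n ^ 4 * p ^ 3" .
    have "real t ^ 2 * p \<le> E"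
      unfolding p_def P_def E_def using fin by (intro level_le_energy) auto
    moreover have "real t ^ 3 * p \<le> d * n ^ 3"
    proof -
      have "real t ^ 3 * p \<le> energy 3 A' A'"
        unfolding p_def P_def using fin by (intro level_le_energy) auto
      also have "\<dots> \<le> energy 3 A A'" using A fin A' by (intro energy_mono_left) auto
      also have "\<dots> \<le> d * n * real (card A') ^ 2"
        using bound fin unfolding cubic_energy_bound_def n_def by blast
      also have "\<dots> \<le> d * n * n\<^sup>2"
        using d0 n A A' by (intro mult_left_mono power_mono) (auto simp: n_def card_mono)
      finally show ?thesis by (simp add: power2_eq_square power3_eq_cube mult.assoc)
    qed
    \<comment> \<open>The bound for \<open>g^4\<close> contains \<open>p^3\<close>, and
      \<open>t^8\<close> is available to absorb it: one factor \<open>p\<close> is paid by the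
      second moment, two by the third, and 2 + 3 + 3 = 8.\<close>
    ultimately have "(real t ^ 2 * p) * (real t ^ 3 * p)\<^sup>2 \<le> E * (d * n ^ 3)\<^sup>2"
      using E by (intro mult_mono[OF _ power_mono]) (auto simp: p_def)
    also have "(real t ^ 2 * p) * (real t ^ 3 * p)\<^sup>2 = real t ^ 8 * p ^ 3" by algebra
    also have "E * (d * n ^ 3)\<^sup>2 = E * d\<^sup>2 * n ^ 6" by algebra
    finally have 2: "real t ^ 8 * p ^ 3 \<le> E * d\<^sup>2 * n ^ 6" .
    have "(real t ^ 2 * g) ^ 4 * n ^ 8 = real t ^ 8 * (n ^ 8 * g ^ 4)" by algebra
    also have "\<dots> \<le> real t ^ 8 * (256 * s ^ 7 * d\<^sup>2 * n ^ 4 * p ^ 3)" using 1 by (intro mult_left_mono) auto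
    also have "\<dots> = 256 * s ^ 7 * d\<^sup>2 * n ^ 4 * (real t ^ 8 * p ^ 3)" by simp
    also have "\<dots> \<le> 256 * s ^ 7 * d\<^sup>2 * n ^ 4 * (E * d\<^sup>2 * n ^ 6)"
      using 2 by (intro mult_left_mono) (auto simp: s_def)
    also have "\<dots> = M ^ 4 * n ^ 8" unfolding M by algebra
    finally have "(real t ^ 2 * g) ^ 4 \<le> M ^ 4" by (rule mult_right_le_imp_le) (use n in simp)
    then have "real t ^ 2 * g \<le> M" using M(1) by (subst (asm) power_mono_iff) (auto simp: g_def)
    then show ?thesis unfolding g_def G_def .
  qed
  moreover have "rep A' A' x \<le> card A" for x
    using rep_le_left[OF fin(3)] card_mono[OF A(1) A'] by (rule order_trans)
  ultimately have "(\<Sum>z\<in>S' \<times> S'. real (rep A' A' (sub z)) ^ 2) \<le> real 2 * M * harm (card A)"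
    using fin by (intro sum_power_le_levels) auto
  then have "(\<Sum>z\<in>S' \<times> S'. real (rep A' A' (sub z)) ^ 2) ^ 4 \<le> (2 * M * harm (card A)) ^ 4"
    by (intro power_mono) (auto intro: sum_nonneg)
  also have "\<dots> = 16 * M ^ 4 * harm (card A) ^ 4" by (simp add: power_mult_distrib)
  finally show ?thesis unfolding M n_def S_def s_def E_def by (simp add: mult_ac)
qed

text \<open>The second energy \<open>E\<close> of \<open>A'\<close> is the quantity to eliminate.
  Equal sums force it to be at least \<open>n^4 / (16 * s)\<close>. The lower and upper bounds for
  collisions give an estimate of its eighth power that is linear in \<open>E\<close>, hence an upper
  bound for its seventh power.\<close>

theorem card_le_card_sums:
  fixes A :: "'a :: ab_group_add set"
  assumes A: "finite A" "A \<noteq> {}" and bound: "cubic_energy_bound A d"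
  shows "real (card A) ^ 11 \<le> 2 ^ 28 * harm (card A) ^ 2 * d ^ 4 * real (card (sumset A A)) ^ 7"
proof -
  obtain S' A' where S': "S' \<subseteq> sumset A A" and A': "A' \<subseteq> A" "card A \<le> 2 * card A'"
    and popS: "\<And>x. x \<in> S' \<Longrightarrow> (card A)\<^sup>2 \<le> 4 * card (sumset A A) * card {p \<in> A \<times> A. add p = x}"
    and popA: "\<And>x. x \<in> A' \<Longrightarrow> card A \<le> 2 * card {y \<in> A. x + y \<in> S'}"
    by (rule popular_sums[OF A]) blast
  define n s E h where "n = real (card A)" and "s = real (card (sumset A A))" and "E = energy 2 A' A'"
    and "h = (harm (card A) :: real)"
  define Q where "Q = (\<Sum>z\<in>S' \<times> S'. real (rep A' A' (sub z)) ^ 2)"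
  have fin: "finite A'" "finite S'" using A A' S' by (auto intro: finite_subset)
  have n: "n > 0" unfolding n_def using A by (simp add: card_gt_0_iff)
  have d0: "d \<ge> 0" using cubic_energy_bound_nonneg A bound by blast
  have h0: "h \<ge> 0" unfolding h_def by (rule harm_nonneg)
  have Q0: "Q \<ge> 0" unfolding Q_def by (intro sum_nonneg) auto
  have E0: "E \<ge> 0" unfolding E_def by (rule energy_nonneg)
  have E: "n ^ 4 \<le> 16 * s * E"
  proof -
    have "n / 2 \<le> real (card A')" using A'(2) unfolding n_def by linarith
    then have "((n / 2) ^ 2)\<^sup>2 \<le> ((real (card A'))\<^sup>2)\<^sup>2" using n by (intro power_mono) auto
    also have "\<dots> = real (card (A' \<times> A')) ^ 2" by (simp add: card_cartesian_product power2_eq_square)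
    also have "\<dots> \<le> real (card (sumset A A)) * real (coinc (A' \<times> A') add (A' \<times> A') add)"
      using fin A A' by (intro card_sq_le_image_coinc) (auto simp: sumset_def)
    \<comment> \<open>Exchanging two variables: \<open>a + b = c + d\<close> is the same as
      \<open>a - d = c - b\<close>.\<close>
    also have "coinc (A' \<times> A') add (A' \<times> A') add = coinc (A' \<times> A') sub (A' \<times> A') sub"
      unfolding coinc_def
      by (rule bij_betw_same_card[of "\<lambda>((a, b), (c, d)). ((a, d), (c, b))"])
         (auto simp: bij_betw_def inj_on_def image_def algebra_simps)
    finally show ?thesis
      using coinc_sub_eq_energy[of A' A'] fin
      by (simp add: s_def E_def power_divide)
  qed
  then have Epos: "E > 0" using n E0 by (cases "E = 0") auto
  define T where "T = {(x, x', y). x \<in> A' \<and> x' \<in> A' \<and> y \<in> A \<and> x + y \<in> S'}"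
  define f where "f = (\<lambda>(x :: 'a, x', y :: 'a). (x - x', y))"
  define N where "N = real (coinc T f T f)"
  have low: "n * E \<le> 4 * N"
    using coinc_lower[OF A(1) fin(1) popA] unfolding n_def E_def N_def T_def f_def .
  have "energy 3 A A \<le> d * n ^ 3"
    using A bound unfolding cubic_energy_bound_def n_def
    by (auto simp: power2_eq_square power3_eq_cube mult.assoc)
  then have up: "N\<^sup>2 \<le> d * n ^ 3 * Q"
    using coinc_upper[OF A(1) A'(1) fin(2)] Q0 unfolding N_def T_def f_def Q_def
    by (meson mult_right_mono order_trans)
  have Q4: "Q ^ 4 \<le> 4096 * h ^ 4 * s ^ 7 * d ^ 4 * n\<^sup>2 * E"
    using sum_rep_sq_popular_sums[OF A bound A'(1) S' popS] unfolding Q_def h_def s_def n_def E_def .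
  \<comment> \<open>\<open>N\<close> is controlled through its square and \<open>Q\<close> through
    its fourth power, so the eighth power chains both bounds; the constant is
    \<open>4^8 * 4096 = 2^28\<close>.\<close>
  have "(n * E) ^ 8 \<le> (4 * N) ^ 8" using low n E0 by (intro power_mono) auto
  also have "\<dots> = 4 ^ 8 * (N\<^sup>2) ^ 4" by (simp add: power_mult_distrib)
  also have "\<dots> \<le> 4 ^ 8 * (d * n ^ 3 * Q) ^ 4" using up by (intro mult_left_mono power_mono) auto
  also have "\<dots> = 4 ^ 8 * d ^ 4 * n ^ 12 * Q ^ 4" by (simp add: power_mult_distrib)
  also have "\<dots> \<le> 4 ^ 8 * d ^ 4 * n ^ 12 * (4096 * h ^ 4 * s ^ 7 * d ^ 4 * n\<^sup>2 * E)"
    using Q4 n d0 by (intro mult_left_mono) auto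
  also have "\<dots> = (2 ^ 28 * h ^ 4 * s ^ 7 * d ^ 8 * n ^ 6) * (n ^ 8 * E)" by algebra
  also have "(n * E) ^ 8 = E ^ 7 * (n ^ 8 * E)" by algebra
  finally have "E ^ 7 * (n ^ 8 * E) \<le> (2 ^ 28 * h ^ 4 * s ^ 7 * d ^ 8 * n ^ 6) * (n ^ 8 * E)" .
  then have E7: "E ^ 7 \<le> 2 ^ 28 * h ^ 4 * s ^ 7 * d ^ 8 * n ^ 6"
    by (rule mult_right_le_imp_le) (use n Epos in simp)
  have "n ^ 22 * n ^ 6 = (n ^ 4) ^ 7" by (simp add: power_mult[symmetric] power_add[symmetric])
  also have "\<dots> \<le> (16 * s * E) ^ 7" using E n by (intro power_mono) auto
  also have "\<dots> = 2 ^ 28 * s ^ 7 * E ^ 7" by (simp add: power_mult_distrib)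
  also have "\<dots> \<le> 2 ^ 28 * s ^ 7 * (2 ^ 28 * h ^ 4 * s ^ 7 * d ^ 8 * n ^ 6)"
    using E7 by (intro mult_left_mono) (auto simp: s_def)
  also have "\<dots> = (2 ^ 28 * h\<^sup>2 * d ^ 4 * s ^ 7)\<^sup>2 * n ^ 6" by algebra
  finally have "n ^ 22 \<le> (2 ^ 28 * h\<^sup>2 * d ^ 4 * s ^ 7)\<^sup>2"
    by (rule mult_right_le_imp_le) (use n in simp)
  then have "(n ^ 11)\<^sup>2 \<le> (2 ^ 28 * h\<^sup>2 * d ^ 4 * s ^ 7)\<^sup>2" by (simp flip: power_mult)
  then have "n ^ 11 \<le> 2 ^ 28 * h\<^sup>2 * d ^ 4 * s ^ 7"
    by (rule power2_le_imp_le) (auto simp: s_def)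
  then show ?thesis unfolding n_def h_def s_def .
qed

subsection \<open>Additive against multiplicative cubic energy\<close>

lemma inj_on_ln_pos: "Y \<subseteq> {0<..} \<Longrightarrow> inj_on ln (Y :: real set)"
  by (auto simp: inj_on_def subset_iff)

text \<open>If \<open>x + c = ln a\<close> and \<open>a - b\<close> lies in \<open>D\<close>, then
  the point \<open>(exp c, a - b)\<close> is on the line of slope \<open>exp x\<close> and intercept
  \<open>- b\<close>, because \<open>exp x * exp c = a\<close>. A level set of size \<open>k\<close>
  thus produces at least \<open>k * t * \<nu>\<close> incidences with \<open>k * card B\<close>
  lines; in the cubic case of the incidence bound, \<open>k^2\<close> cancels and leaves the
  claim.\<close>

lemma ln_image_level_le:
  fixes A B C D Z :: "real set"
  assumes fin: "finite A" "finite B" "finite C" "finite D" "finite Z" and pos: "A \<subseteq> {0<..}"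
    and nu: "\<nu> > 0" "\<And>a. a \<in> A \<Longrightarrow> \<nu> \<le> real (card {b \<in> B. a - b \<in> D})" and t: "1 \<le> t"
  shows "real t ^ 3 * card {x \<in> Z. t \<le> rep (ln ` A) C x} * \<nu> ^ 3
    \<le> 343 * (real (card C) * card D * card B) ^ 2"
proof -
  define X where "X = {x \<in> Z. t \<le> rep (ln ` A) C x}"
  define k p q b where "k = real (card X)" and "p = real (card C)" and "q = real (card D)" and "b = real (card B)"
  have finX: "finite X" unfolding X_def using fin by simp
  show ?thesis
  proof (cases "X = {}")
    case False
    then obtain x where x: "x \<in> X" by auto
    have k: "k > 0" unfolding k_def using False finX by (simp add: card_gt_0_iff)
    have "A \<noteq> {}"
    proof
      assume "A = {}"
      then have "rep (ln ` A) C x = 0" by (simp add: rep_def)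
      then show False using x t unfolding X_def by simp
    qed
    then obtain a where a: "a \<in> A" by auto
    have nuq: "\<nu> \<le> q"
    proof -
      have "card {b \<in> B. a - b \<in> D} \<le> card D"
        by (rule card_inj_on_le[of "\<lambda>b. a - b"]) (use fin in \<open>auto simp: inj_on_def\<close>)
      then show ?thesis using nu(2)[OF a] unfolding q_def by linarith
    qed
    have Anu: "real (card A) * \<nu> \<le> b * q"
    proof -
      have "real (card A) * \<nu> = (\<Sum>a\<in>A. \<nu>)" by simp
      also have "\<dots> \<le> (\<Sum>a\<in>A. real (card {b \<in> B. a - b \<in> D}))" using nu by (intro sum_mono)
      also have "\<dots> = real (card (SIGMA a : A. {b \<in> B. a - b \<in> D}))" using fin by simp
      also have "card (SIGMA a : A. {b \<in> B. a - b \<in> D}) \<le> card (B \<times> D)"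
        by (rule card_inj_on_le[of "\<lambda>(a, b). (b, a - b)"]) (use fin in \<open>auto simp: inj_on_def\<close>)
      finally show ?thesis unfolding b_def q_def by (simp add: card_cartesian_product)
    qed
    have tp: "real t \<le> p"
      using x rep_le_right[OF fin(3), of "ln ` A" x] unfolding X_def p_def by auto
    have kt: "k * real t \<le> real (card A) * p"
    proof -
      have "card X * t \<le> (\<Sum>x\<in>X. rep (ln ` A) C x)" using sum_bounded_below[of X t "rep (ln ` A) C"] by (simp add: X_def)
      also have "\<dots> \<le> card (ln ` A) * card C" using fin finX by (intro sum_rep_le) auto
      also have "card (ln ` A) = card A" by (rule card_image[OF inj_on_ln_pos[OF pos]])
      finally show ?thesis unfolding k_def p_def by (simp flip: of_nat_mult)
    qed
    define L where "L = (\<lambda>(x, b). (exp x, - b)) ` (X \<times> B)"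
    have finL: "finite L" unfolding L_def using finX fin by simp
    have cardL: "real (card L) = k * b"
      unfolding L_def k_def b_def by (subst card_image) (auto simp: inj_on_def card_cartesian_product)
    define N where "N = real (card (incidences (exp ` C) D L))"
    have low: "k * real t * \<nu> \<le> N"
    proof -
      define J where "J = (SIGMA z : (SIGMA x : X. {c \<in> C. x + c \<in> ln ` A}). {b \<in> B. exp (fst z + snd z) - b \<in> D})"
      have "k * real t * \<nu> = (\<Sum>x\<in>X. real t) * \<nu>" by (simp add: k_def)
      also have "\<dots> \<le> (\<Sum>x\<in>X. real (rep (ln ` A) C x)) * \<nu>"
        using nu(1) by (intro mult_right_mono sum_mono) (auto simp: X_def)
      also have "\<dots> = (\<Sum>z\<in>(SIGMA x : X. {c \<in> C. x + c \<in> ln ` A}). \<nu>)"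
        unfolding rep_eq_card_right using fin finX by simp
      also have "\<dots> \<le> (\<Sum>z\<in>(SIGMA x : X. {c \<in> C. x + c \<in> ln ` A}). real (card {b \<in> B. exp (fst z + snd z) - b \<in> D}))"
        using pos by (intro sum_mono nu(2)) auto
      also have "\<dots> = real (card J)"
        unfolding J_def using fin finX by (subst card_SigmaI) auto
      also have "card J \<le> card (incidences (exp ` C) D L)"
      proof (rule card_inj_on_le[of "\<lambda>((x, c), b). ((exp x, - b), exp c)"])
        show "finite (incidences (exp ` C) D L)"
          by (rule finite_subset[of _ "L \<times> exp ` C"]) (use finL fin in \<open>auto simp: incidences_def\<close>)
      qed (auto simp: inj_on_def J_def incidences_def L_def exp_add)
      finally show ?thesis unfolding N_def by simp
    qed
    have "N \<le> 4 * (k * b) \<or> N ^ 3 \<le> 343 * (p * q * (k * b))\<^sup>2"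
    proof -
      have "card (exp ` C) = card C" by (intro card_image) (auto simp: inj_on_def)
      moreover have "\<And>l. l \<in> L \<Longrightarrow> fst l > 0" unfolding L_def by auto
      ultimately show ?thesis
        using Szemeredi_Trotter_grid[of "exp ` C" D L] fin finL
        unfolding N_def cardL[symmetric] p_def q_def by auto
    qed
    then have "k * real t ^ 3 * \<nu> ^ 3 \<le> 343 * (p * q * b)\<^sup>2"
    proof
      \<comment> \<open>In the linear case of the incidence bound, \<open>t * \<nu> <= 4 * b\<close>
        is combined with the trivial estimates \<open>kt\<close>, \<open>tp\<close>,
        \<open>Anu\<close> and \<open>nuq\<close>, which reach the same product
        \<open>(p * q * b)^2\<close>.\<close>
      assume "N \<le> 4 * (k * b)"
      with low have "k * (real t * \<nu>) \<le> k * (4 * b)" by (simp add: mult_ac)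
      then have tnu: "real t * \<nu> \<le> 4 * b" using k by simp
      have "k * real t ^ 3 * \<nu> ^ 3 = (k * real t) * (real t * (real t * \<nu>)) * \<nu>\<^sup>2" by algebra
      also have "\<dots> \<le> (real (card A) * p) * (p * (4 * b)) * \<nu>\<^sup>2"
        using nu(1) by (intro mult_right_mono mult_mono[OF kt mult_mono[OF tp tnu]]) (auto simp: p_def b_def)
      also have "\<dots> = (4 * p\<^sup>2 * b) * ((real (card A) * \<nu>) * \<nu>)" by algebra
      also have "\<dots> \<le> (4 * p\<^sup>2 * b) * ((b * q) * q)"
        using nu(1) by (intro mult_left_mono mult_mono[OF Anu nuq]) (auto simp: b_def q_def)
      also have "\<dots> = 4 * (p * q * b)\<^sup>2" by algebra
      also have "\<dots> \<le> 343 * (p * q * b)\<^sup>2" by (intro mult_right_mono) auto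
      finally show ?thesis .
    next
      assume N: "N ^ 3 \<le> 343 * (p * q * (k * b))\<^sup>2"
      have "(k * real t ^ 3 * \<nu> ^ 3) * k\<^sup>2 = (k * real t * \<nu>) ^ 3" by algebra
      also have "\<dots> \<le> N ^ 3" using low k nu(1) by (intro power_mono) auto
      also note N
      also have "343 * (p * q * (k * b))\<^sup>2 = (343 * (p * q * b)\<^sup>2) * k\<^sup>2" by algebra
      finally show ?thesis by (rule mult_right_le_imp_le) (use k in simp)
    qed
    then show ?thesis unfolding k_def p_def q_def b_def X_def by (simp add: mult_ac)
  next
    case True
    then show ?thesis unfolding X_def[symmetric] by simp
  qed
qed

text \<open>Two pigeonhole steps, each losing a harmonic number. A large third energy yields a level
  \<open>t\<close> and its popular differences \<open>D\<close>; the pairs with difference in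
  \<open>D\<close> then yield a threshold \<open>\<nu>\<close> and the set \<open>A'\<close> of
  elements that lie in at least \<open>\<nu>\<close> of them.\<close>

lemma not_cubic_energy_boundE:
  fixes X :: "'a :: ab_group_add set"
  assumes X: "finite X" "X \<noteq> {}" and K: "K > 0" and not_bound: "\<not> cubic_energy_bound X K"
  obtains B D t A' \<nu> where "finite B" "finite D" "A' \<subseteq> X" "A' \<noteq> {}" "\<nu> > 0" "card B > 0" "card D > 0"
    "\<And>a. a \<in> A' \<Longrightarrow> \<nu> \<le> real (card {b \<in> B. a - b \<in> D})"
    "K * real (card X) * real (card B) ^ 2 \<le> 3 * harm (card X) * (real t ^ 3 * real (card D))"
    "real t * real (card D) \<le> 2 * harm (card X) * (\<nu> * real (card A'))"
proof -
  define h where "h = (harm (card X) :: real)"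
  have h: "h > 0" unfolding h_def using X by (simp add: card_gt_0_iff)
  from not_bound obtain B where B: "finite B" and big: "energy 3 X B > K * real (card X) * real (card B) ^ 2"
    unfolding cubic_energy_bound_def by auto
  have "card B > 0"
  proof (rule ccontr)
    assume "\<not> card B > 0"
    then have "B = {}" using B by simp
    then show False using big by (simp add: energy_def diffs_def)
  qed
  define M where "M = K * real (card X) * real (card B) ^ 2 / (3 * h)"
  have M: "M > 0" unfolding M_def using K X \<open>card B > 0\<close> h by (simp add: card_gt_0_iff)
  have "\<exists>t\<in>{1..card X}. M < real t ^ 3 * card {x \<in> diffs X B. t \<le> rep X B x}"
  proof (rule ccontr)
    assume "\<not> (\<exists>t\<in>{1..card X}. M < real t ^ 3 * card {x \<in> diffs X B. t \<le> rep X B x})"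
    then have "energy 3 X B \<le> real 3 * M * harm (card X)"
      unfolding energy_def using X B
      by (intro sum_power_le_levels) (auto intro: rep_le_left simp: not_less)
    also have "\<dots> = K * real (card X) * real (card B) ^ 2"
      unfolding M_def h_def[symmetric] using h by simp
    finally show False using big by simp
  qed
  then obtain t where t: "t \<ge> 1" "M < real t ^ 3 * card {x \<in> diffs X B. t \<le> rep X B x}" by auto
  define D where "D = {x \<in> diffs X B. t \<le> rep X B x}"
  have finD: "finite D" unfolding D_def using X B by simp
  have D: "card D > 0" using t(2) M unfolding D_def[symmetric] by (cases "card D = 0") auto
  define w where "w a = real (card {b \<in> B. a - b \<in> D})" for a
  have sum_w: "real t * real (card D) \<le> sum w X"
  proof -
    have "card D * t \<le> (\<Sum>x\<in>D. rep X B x)" using sum_bounded_below[of D t "rep X B"] by (simp add: D_def)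
    also have "\<dots> = card {p \<in> X \<times> B. sub p \<in> D}" using X B finD by (intro sum_rep_eq_card)
    also have "{p \<in> X \<times> B. sub p \<in> D} = (SIGMA a : X. {b \<in> B. a - b \<in> D})" by auto
    also have "card \<dots> = (\<Sum>a\<in>X. card {b \<in> B. a - b \<in> D})" using X B by simp
    finally have "real (card D * t) \<le> real (\<Sum>a\<in>X. card {b \<in> B. a - b \<in> D})" by (rule of_nat_mono)
    then show ?thesis unfolding w_def by (simp add: mult.commute)
  qed
  have td: "real t * real (card D) > 0" using t(1) D by simp
  \<comment> \<open>The factor 2 makes the contradiction strict: without a suitable threshold, the
    sum of \<open>w\<close> would be at most half of its lower bound.\<close>
  define M' where "M' = real t * real (card D) / (2 * h)"
  have M': "M' > 0" unfolding M'_def using td h by simp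
  have "\<exists>a\<in>X. M' < w a * card {b \<in> X. w a \<le> w b}"
  proof (rule ccontr)
    assume "\<not> (\<exists>a\<in>X. M' < w a * card {b \<in> X. w a \<le> w b})"
    then have "sum w X \<le> M' * harm (card X)"
      using X by (intro sum_le_popular) (auto simp: not_less w_def)
    also have "\<dots> = real t * real (card D) / 2" unfolding M'_def h_def[symmetric] using h by simp
    finally show False using sum_w td by simp
  qed
  then obtain a where a: "a \<in> X" "M' < w a * card {b \<in> X. w a \<le> w b}" by auto
  show ?thesis
  proof (rule that[of B D "{b \<in> X. w a \<le> w b}" "w a" t])
    show "w a > 0" using a(2) M' by (cases "w a = 0") (auto simp: w_def)
    show "K * real (card X) * real (card B) ^ 2 \<le> 3 * harm (card X) * (real t ^ 3 * real (card D))"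
      using t(2) h unfolding M_def D_def[symmetric] h_def[symmetric] by (simp add: field_simps)
    show "real t * real (card D) \<le> 2 * harm (card X) * (w a * real (card {b \<in> X. w a \<le> w b}))"
      using a(2) h unfolding M'_def h_def[symmetric] by (simp add: field_simps)
  qed (use a B finD D \<open>card B > 0\<close> in \<open>auto simp: w_def\<close>)
qed

text \<open>The popular differences \<open>D\<close> of \<open>X\<close> and \<open>B\<close> give many \<open>a \<in> X\<close> with many representations \<open>a = b + d\<close>;
  incidences between \<open>exp C \<times> D\<close> and the lines \<open>y = exp x \<cdot> c - b\<close> then bound the level sets of quotients.\<close>

lemma cubic_energy_step:
  fixes X :: "real set"
  assumes X: "finite X" "X \<noteq> {}" "X \<subseteq> {0<..}" and K: "K > 0" and not_bound: "\<not> cubic_energy_bound X K"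
  obtains A' where "A' \<subseteq> X" "A' \<noteq> {}"
    "\<And>C. finite C \<Longrightarrow> energy 3 (ln ` A') C
      \<le> 24696 * harm (card X) ^ 5 / (K * card X) * real (card A') ^ 3 * real (card C) ^ 2"
proof -
  obtain B D t A' \<nu> where fin: "finite B" "finite D" and A': "A' \<subseteq> X" "A' \<noteq> {}" and nu: "\<nu> > 0"
    and pos: "card B > 0" "card D > 0"
    and rich: "\<And>a. a \<in> A' \<Longrightarrow> \<nu> \<le> real (card {b \<in> B. a - b \<in> D})"
    and B: "K * real (card X) * real (card B) ^ 2 \<le> 3 * harm (card X) * (real t ^ 3 * real (card D))"
    and D: "real t * real (card D) \<le> 2 * harm (card X) * (\<nu> * real (card A'))"
    by (rule not_cubic_energy_boundE[OF X(1,2) K not_bound]) blast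
  define h b q n a where "h = (harm (card X) :: real)" and "b = real (card B)" and "q = real (card D)"
    and "n = real (card X)" and "a = real (card A')"
  have finA': "finite A'" using A' X finite_subset by blast
  have h: "h > 0" "n > 0" unfolding h_def n_def using X by (auto simp: card_gt_0_iff)
  have bq: "b > 0" "q > 0" unfolding b_def q_def using pos by auto
  have A'pos: "A' \<subseteq> {0<..}" using A' X by auto
  have cardln: "card (ln ` A') = card A'" by (rule card_image[OF inj_on_ln_pos[OF A'pos]])
  have a0: "a \<ge> 0" unfolding a_def by simp
  have "q\<^sup>2 * b\<^sup>2 * (K * n) \<le> 24 * h ^ 4 * a ^ 3 * \<nu> ^ 3"
  proof -
    have "(K * n * b\<^sup>2) * q ^ 2 \<le> (3 * h * (real t ^ 3 * q)) * q\<^sup>2"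
      using B unfolding b_def q_def n_def h_def by (intro mult_right_mono) auto
    \<comment> \<open>The factor \<open>q^2\<close> was inserted to complete the cube of
      \<open>t * q\<close>, which the second pigeonhole bounds; this eliminates
      \<open>t\<close>.\<close>
    also have "\<dots> = 3 * h * (real t * q) ^ 3" by algebra
    also have "\<dots> \<le> 3 * h * (2 * h * (\<nu> * a)) ^ 3"
      using D h unfolding q_def a_def h_def by (intro mult_left_mono power_mono) (auto simp: harm_nonneg)
    also have "\<dots> = 24 * h ^ 4 * a ^ 3 * \<nu> ^ 3" by algebra
    finally show ?thesis by (simp add: mult_ac)
  qed
  then have key: "(q * b)\<^sup>2 / \<nu> ^ 3 \<le> 24 * h ^ 4 * a ^ 3 / (K * n)"
    using K h nu by (simp add: field_simps)
  show ?thesis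
  proof (rule that[OF A'])
    fix C :: "real set"
    assume C: "finite C"
    define p where "p = real (card C)"
    have "energy 3 (ln ` A') C \<le> real 3 * (343 * (p * q * b)\<^sup>2 / \<nu> ^ 3) * harm (card (ln ` A'))"
      unfolding energy_def
    proof (rule sum_power_le_levels)
      fix t :: nat assume "1 \<le> t"
      then have "real t ^ 3 * card {x \<in> diffs (ln ` A') C. t \<le> rep (ln ` A') C x} * \<nu> ^ 3 \<le> 343 * (p * q * b)\<^sup>2"
        unfolding p_def q_def b_def using finA' fin C A'pos nu rich by (intro ln_image_level_le) auto
      then show "real t ^ 3 * card {x \<in> diffs (ln ` A') C. t \<le> rep (ln ` A') C x} \<le> 343 * (p * q * b)\<^sup>2 / \<nu> ^ 3"
        using nu by (simp add: pos_le_divide_eq)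
    qed (use finA' C in \<open>auto intro: rep_le_left\<close>)
    also have "\<dots> = 1029 * p\<^sup>2 * harm (card A') * ((q * b)\<^sup>2 / \<nu> ^ 3)"
      unfolding cardln by (simp add: power_mult_distrib)
    \<comment> \<open>1029 = 3 * 343, from the level summation and the incidence bound; with 24 from
      \<open>key\<close> it gives 24696.\<close>
    also have "\<dots> \<le> 1029 * p\<^sup>2 * h * (24 * h ^ 4 * a ^ 3 / (K * n))"
      using key nu A' X h unfolding h_def
      by (intro mult_mono harm_mono mult_left_mono mult_nonneg_nonneg) (auto simp: card_mono harm_nonneg)
    also have "\<dots> = 24696 * h ^ 5 / (K * n) * a ^ 3 * p\<^sup>2"
      by (simp add: power2_eq_square eval_nat_numeral)
    finally show "energy 3 (ln ` A') C
      \<le> 24696 * harm (card X) ^ 5 / (K * card X) * real (card A') ^ 3 * real (card C) ^ 2"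
      unfolding h_def n_def a_def p_def .
  qed
qed

text \<open>Convexity of the cube at \<open>u / p\<close> and \<open>v / q\<close> with weights
  \<open>p\<close> and \<open>q\<close>; the defect factors explicitly.\<close>

lemma add_cube_le_weighted:
  fixes p q u v :: real
  assumes "p > 0" "q > 0" "u \<ge> 0" "v \<ge> 0"
  shows "(u + v) ^ 3 \<le> (p + q)\<^sup>2 * (u ^ 3 / p\<^sup>2 + v ^ 3 / q\<^sup>2)"
proof -
  define a b where "a = u / p" and "b = v / q"
  have uv: "u = p * a" "v = q * b" and ab: "a \<ge> 0" "b \<ge> 0" unfolding a_def b_def using assms by auto
  have "(p + q)\<^sup>2 * (p * a ^ 3 + q * b ^ 3) - (p * a + q * b) ^ 3
    = p * q * (a - b)\<^sup>2 * ((2 * p + q) * a + (2 * q + p) * b)" by algebra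
  also have "\<dots> \<ge> 0" using assms ab by auto
  finally have "(p * a + q * b) ^ 3 \<le> (p + q)\<^sup>2 * (p * a ^ 3 + q * b ^ 3)" by simp
  moreover have "u ^ 3 / p\<^sup>2 = p * a ^ 3" "v ^ 3 / q\<^sup>2 = q * b ^ 3"
    unfolding uv using assms by (simp_all add: power2_eq_square power3_eq_cube)
  ultimately show ?thesis unfolding uv by simp
qed

text \<open>The cube root of the third energy is the norm with exponent 3 of the representation
  function, which is additive on disjoint unions; this is its triangle inequality. It is why the
  bounds for the pieces are normalised by the cube of their size.\<close>

lemma energy_three_Un_le:
  fixes Y Z :: "'a :: ab_group_add set"
  assumes fin: "finite Y" "finite Z" "finite C" and disj: "Y \<inter> Z = {}"
    and Y: "energy 3 Y C \<le> M * real (card Y) ^ 3" and Z: "energy 3 Z C \<le> M * real (card Z) ^ 3"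
  shows "energy 3 (Y \<union> Z) C \<le> M * real (card (Y \<union> Z)) ^ 3"
proof (cases "Y = {} \<or> Z = {}")
  case False
  define p q where "p = real (card Y)" and "q = real (card Z)"
  have pq: "p > 0" "q > 0" unfolding p_def q_def using False fin by (auto simp: card_gt_0_iff)
  let ?D = "diffs (Y \<union> Z) C"
  have rep: "real (rep (Y \<union> Z) C x) = real (rep Y C x) + real (rep Z C x)" for x
  proof -
    have "{a \<in> Y \<union> Z. a - x \<in> C} = {a \<in> Y. a - x \<in> C} \<union> {a \<in> Z. a - x \<in> C}" by auto
    then show ?thesis
      unfolding rep_eq_card_left using fin disj by (simp add: card_Un_disjoint disjoint_iff)
  qed
  have "energy 3 (Y \<union> Z) C
    \<le> (\<Sum>x\<in>?D. (p + q)\<^sup>2 * (real (rep Y C x) ^ 3 / p\<^sup>2 + real (rep Z C x) ^ 3 / q\<^sup>2))"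
    unfolding energy_def rep using pq by (intro sum_mono add_cube_le_weighted) auto
  also have "\<dots> = (p + q)\<^sup>2 * ((\<Sum>x\<in>?D. real (rep Y C x) ^ 3) / p\<^sup>2 + (\<Sum>x\<in>?D. real (rep Z C x) ^ 3) / q\<^sup>2)"
    by (simp add: sum.distrib sum_divide_distrib flip: sum_distrib_left)
  also have "\<dots> \<le> (p + q)\<^sup>2 * (M * p ^ 3 / p\<^sup>2 + M * q ^ 3 / q\<^sup>2)"
    using fin Y Z unfolding p_def q_def
    by (intro mult_left_mono add_mono divide_right_mono order_trans[OF sum_rep_power_le_energy]) auto
  also have "\<dots> = M * (p + q) ^ 3"
    using pq by (simp add: power2_eq_square power3_eq_cube field_simps)
  finally show ?thesis unfolding p_def q_def using fin disj by (simp add: card_Un_disjoint)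
qed (use Y Z in auto)

text \<open>Take a maximal \<open>Y\<close> whose logarithms satisfy the cubic normalisation. If
  \<open>Y\<close> fills half of \<open>A\<close>, two factors \<open>card Y\<close> are traded for
  \<open>card A\<close>. Otherwise its complement \<open>X\<close> has more than half of the
  elements, and failure of the additive bound on \<open>X\<close> would supply a piece of
  \<open>X\<close> that can be glued to \<open>Y\<close>.\<close>

theorem cubic_energy_dichotomy:
  fixes A :: "real set"
  assumes A: "finite A" "A \<noteq> {}" "A \<subseteq> {0<..}" and K: "K > 0"
  obtains X where "X \<subseteq> A" "card A \<le> 2 * card X"
    "cubic_energy_bound X K \<or> cubic_energy_bound (ln ` X) (49392 * harm (card A) ^ 5 * card A / K)"
proof -
  define n h where "n = real (card A)" and "h = (harm (card A) :: real)"
  \<comment> \<open>49392 is twice 24696, as the set to which the step lemma is applied has at least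
    \<open>n / 2\<close> elements.\<close>
  define M where "M = 49392 * h ^ 5 / (K * n)"
  have n: "n > 0" "h > 0" unfolding n_def h_def using A by (auto simp: card_gt_0_iff)
  have M: "M > 0" unfolding M_def using n K by simp
  define good where "good Y \<longleftrightarrow> Y \<subseteq> A \<and>
    (\<forall>C. finite C \<longrightarrow> energy 3 (ln ` Y) C \<le> M * real (card Y) ^ 3 * real (card C) ^ 2)" for Y
  have "finite {Y. good Y}" by (rule finite_subset[of _ "Pow A"]) (use A in \<open>auto simp: good_def\<close>)
  moreover have "good {}" unfolding good_def by (simp add: energy_def diffs_def)
  ultimately obtain Y where Y: "good Y" and max: "\<And>Y'. good Y' \<Longrightarrow> Y \<subseteq> Y' \<Longrightarrow> Y' = Y"
    using finite_has_maximal[of "{Y. good Y}"] by (metis empty_iff mem_Collect_eq)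
  have YA: "Y \<subseteq> A" using Y unfolding good_def by simp
  have finY: "finite Y" using YA A finite_subset by blast
  show ?thesis
  proof (cases "card A \<le> 2 * card Y")
    case True
    have cardln: "card (ln ` Y) = card Y" using YA A by (intro card_image inj_on_ln_pos) auto
    have "cubic_energy_bound (ln ` Y) (49392 * h ^ 5 * n / K)"
      unfolding cubic_energy_bound_def
    proof (intro allI impI)
      fix C :: "real set"
      assume C: "finite C"
      have "energy 3 (ln ` Y) C \<le> M * real (card Y) ^ 3 * real (card C) ^ 2"
        using Y C unfolding good_def by auto
      also have "\<dots> = M * real (card C) ^ 2 * real (card Y) * real (card Y) ^ 2" by algebra
      also have "\<dots> \<le> M * real (card C) ^ 2 * real (card Y) * n ^ 2"
        unfolding n_def using M YA A by (intro mult_left_mono power_mono) (auto simp: card_mono)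
      also have "\<dots> = (M * n\<^sup>2) * real (card Y) * real (card C) ^ 2" by algebra
      also have "M * n\<^sup>2 = 49392 * h ^ 5 * n / K" unfolding M_def using n by (simp add: power2_eq_square)
      finally show "energy 3 (ln ` Y) C \<le> 49392 * h ^ 5 * n / K * real (card (ln ` Y)) * real (card C) ^ 2"
        unfolding cardln .
    qed
    then show ?thesis using that[OF YA True] unfolding n_def h_def by simp
  next
    case False
    define X where "X = A - Y"
    have X: "finite X" "X \<subseteq> {0<..}" "X \<subseteq> A" unfolding X_def using A by auto
    have cardX: "card A \<le> 2 * card X"
      using False YA finY unfolding X_def by (simp add: card_Diff_subset)
    then have "X \<noteq> {}" using A by auto
    have "cubic_energy_bound X K"
    proof (rule ccontr)
      assume "\<not> cubic_energy_bound X K"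
      then obtain A' where A': "A' \<subseteq> X" "A' \<noteq> {}"
        and bnd: "\<And>C. finite C \<Longrightarrow> energy 3 (ln ` A') C
          \<le> 24696 * harm (card X) ^ 5 / (K * card X) * real (card A') ^ 3 * real (card C) ^ 2"
        using cubic_energy_step[OF X(1) \<open>X \<noteq> {}\<close> X(2) K] by blast
      have finA': "finite A'" using A' X finite_subset by blast
      have le: "24696 * harm (card X) ^ 5 / (K * card X) \<le> M"
      proof -
        have "24696 * harm (card X) ^ 5 / (K * card X) \<le> 24696 * h ^ 5 / (K * (n / 2))"
          unfolding h_def using n K X A cardX
          by (intro frac_le mult_left_mono power_mono harm_mono card_mono) (auto simp: n_def harm_nonneg)
        then show ?thesis unfolding M_def by simp
      qed
      have "good (Y \<union> A')"
        unfolding good_def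
      proof (intro conjI allI impI)
        show "Y \<union> A' \<subseteq> A" using YA A' X by auto
        fix C :: "real set"
        assume C: "finite C"
        have inj: "inj_on ln (Y \<union> A')" using YA A' X A by (intro inj_on_ln_pos) auto
        then have cards: "card (ln ` Y) = card Y" "card (ln ` A') = card A'"
          "card (ln ` Y \<union> ln ` A') = card (Y \<union> A')"
          by (auto simp: card_image inj_on_Un simp flip: image_Un intro!: card_image intro: inj_on_subset)
        have "Y \<inter> A' = {}" using A' unfolding X_def by auto
        then have disj: "ln ` Y \<inter> ln ` A' = {}"
          using inj_on_image_Int[OF inj, of Y A'] by auto
        have "energy 3 (ln ` A') C \<le> M * real (card A') ^ 3 * real (card C) ^ 2"
          using bnd[OF C] le by (smt (verit) mult_right_mono of_nat_0_le_iff zero_le_power)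
        then have "energy 3 (ln ` Y \<union> ln ` A') C
          \<le> (M * real (card C) ^ 2) * real (card (ln ` Y \<union> ln ` A')) ^ 3"
          using Y C finY finA' disj unfolding good_def
          by (intro energy_three_Un_le) (auto simp: cards mult_ac)
        then show "energy 3 (ln ` (Y \<union> A')) C \<le> M * real (card (Y \<union> A')) ^ 3 * real (card C) ^ 2"
          unfolding image_Un cards by (simp add: mult_ac)
      qed
      then have "Y \<union> A' = Y" by (rule max) simp
      then show False using A' unfolding X_def by auto
    qed
    then show ?thesis using that[OF X(3) cardX] by simp
  qed
qed

subsection \<open>The sum-product estimates\<close>

lemma difference_set_eq_diffs: "difference_set A = diffs A A"
  unfolding difference_set_def diffs_def by force

lemma product_set_eq_image: "product_set A B = (\<lambda>(a, b). a * b) ` (A \<times> B)"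
  unfolding product_set_def by force

lemma quotient_set_eq_image: "product_set A (inverse_set A) = (\<lambda>(a, b). a * inverse b) ` (A \<times> A)"
  unfolding product_set_def inverse_set_def by force

lemma card_diffs_ln:
  assumes "A \<subseteq> {0<..}"
  shows "card (diffs (ln ` A) (ln ` A)) = card (product_set A (inverse_set A))"
proof -
  have "diffs (ln ` A) (ln ` A) = (\<lambda>(a, b). ln a - ln b) ` (A \<times> A)"
    unfolding diffs_def image_paired_Times[symmetric] image_image by (simp add: case_prod_unfold)
  also have "\<dots> = (\<lambda>(a, b). ln (a * inverse b)) ` (A \<times> A)"
  proof (intro image_cong refl)
    fix p assume "p \<in> A \<times> A"
    then have "fst p > 0" "snd p > 0" using assms by auto
    then show "(case p of (a, b) \<Rightarrow> ln a - ln b) = (case p of (a, b) \<Rightarrow> ln (a * inverse b))"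
      by (simp add: case_prod_unfold ln_mult ln_inverse)
  qed
  also have "\<dots> = ln ` product_set A (inverse_set A)"
    unfolding quotient_set_eq_image image_image by (simp add: case_prod_unfold)
  finally have "diffs (ln ` A) (ln ` A) = ln ` product_set A (inverse_set A)" .
  moreover have "product_set A (inverse_set A) \<subseteq> {0<..}"
    unfolding quotient_set_eq_image using assms by (auto simp: subset_iff)
  ultimately show ?thesis by (simp add: card_image inj_on_ln_pos)
qed

lemma card_sumset_ln:
  assumes "A \<subseteq> {0<..}"
  shows "card (sumset (ln ` A) (ln ` A)) = card (product_set A A)"
proof -
  have "sumset (ln ` A) (ln ` A) = (\<lambda>(a, b). ln a + ln b) ` (A \<times> A)"
    unfolding sumset_def image_paired_Times[symmetric] image_image by (simp add: case_prod_unfold)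
  also have "\<dots> = (\<lambda>(a, b). ln (a * b)) ` (A \<times> A)"
  proof (intro image_cong refl)
    fix p assume "p \<in> A \<times> A"
    then have "fst p > 0" "snd p > 0" using assms by auto
    then show "(case p of (a, b) \<Rightarrow> ln a + ln b) = (case p of (a, b) \<Rightarrow> ln (a * b))"
      by (simp add: case_prod_unfold ln_mult)
  qed
  also have "\<dots> = ln ` product_set A A"
    unfolding product_set_eq_image image_image by (simp add: case_prod_unfold)
  finally have "sumset (ln ` A) (ln ` A) = ln ` product_set A A" .
  moreover have "product_set A A \<subseteq> {0<..}"
    unfolding product_set_eq_image using assms by (auto simp: subset_iff)
  ultimately show ?thesis by (simp add: card_image inj_on_ln_pos)
qed

lemma card_difference_set_mono: "finite A \<Longrightarrow> B \<subseteq> A \<Longrightarrow> card (difference_set B) \<le> card (difference_set A)"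
  unfolding difference_set_eq_diffs by (intro card_mono) (auto simp: diffs_def)

lemma card_product_set_mono:
  "finite A \<Longrightarrow> B \<subseteq> A \<Longrightarrow> card (product_set B B) \<le> card (product_set A A)"
  unfolding product_set_eq_image by (intro card_mono) auto

lemma card_quotient_set_mono:
  "finite A \<Longrightarrow> B \<subseteq> A \<Longrightarrow> card (product_set B (inverse_set B)) \<le> card (product_set A (inverse_set A))"
  unfolding quotient_set_eq_image by (intro card_mono) auto

lemma card_difference_set_uminus: "card (difference_set (uminus ` A)) = card (difference_set A)"
proof -
  have "diffs (uminus ` A) (uminus ` A) = diffs A A"
  proof (intro equalityI subsetI)
    fix x assume "x \<in> diffs (uminus ` A) (uminus ` A)"
    then obtain a b where "a \<in> A" "b \<in> A" "x = b - a" by (auto simp: diffs_def)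
    then show "x \<in> diffs A A" by (simp add: diffsI)
  next
    fix x assume "x \<in> diffs A A"
    then obtain a b where "a \<in> A" "b \<in> A" "x = - b - (- a)" by (auto simp: diffs_def)
    then show "x \<in> diffs (uminus ` A) (uminus ` A)" using diffsI[of "- b" "uminus ` A" "- a" "uminus ` A"] by simp
  qed
  then show ?thesis unfolding difference_set_eq_diffs by simp
qed

lemma product_set_uminus: "product_set (uminus ` A) (uminus ` A) = product_set A A"
  unfolding product_set_eq_image image_paired_Times[symmetric] image_image by (simp add: case_prod_unfold)

lemma quotient_set_uminus:
  "product_set (uminus ` A) (inverse_set (uminus ` A)) = product_set A (inverse_set A)"
  unfolding quotient_set_eq_image image_paired_Times[symmetric] image_image by (simp add: case_prod_unfold)

section \<open>Harmonic numbers and the reduction to positive sets\<close>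

lemma harm_le_ln: "n > 0 \<Longrightarrow> harm n \<le> 1 + ln (real n)"
  using decseqD[OF decseq_harm_diff_ln, of 0 "n - 1"] by (simp add: harm_def)

lemma one_le_harm: "n > 0 \<Longrightarrow> (1 :: real) \<le> harm n"
  using harm_mono[of 1 n] by (simp add: harm_def)

text \<open>Zero is a single element, so for \<open>card A >= 2\<close> at least a quarter of
  \<open>A\<close> is positive or at least a quarter is negative. Reflecting the negative part
  changes none of the cardinalities involved.\<close>

lemma gtrsim_of_positive:
  fixes f :: "real set \<Rightarrow> nat"
  assumes e: "0 \<le> e" and C: "C > 0" and k: "k > 0"
    and pos: "\<And>A. finite A \<Longrightarrow> A \<noteq> {} \<Longrightarrow> A \<subseteq> {0<..} \<Longrightarrow>
      real (card A) powr e \<le> C * harm (card A) ^ k * (real (card (difference_set A)) + real (f A))"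
    and mono: "\<And>A B. finite A \<Longrightarrow> B \<subseteq> A \<Longrightarrow> f B \<le> f A"
    and neg: "\<And>A. f (uminus ` A) = f A"
  shows "(\<lambda>A. real (card (difference_set A)) + real (f A)) \<greatersim> (\<lambda>A. real (card A) powr e)"
  unfolding gtrsim_def
proof (intro exI conjI allI impI)
  \<comment> \<open>\<open>4 powr e\<close> pays for passing to a quarter of the set,
    \<open>3 ^ k\<close> for replacing harmonic numbers by logarithms.\<close>
  show "real k > 0" "4 powr e * C * 3 ^ k > 0" using C k by auto
  fix A :: "real set"
  assume A: "finite A \<and> 2 \<le> card A"
  define n where "n = card A"
  define S where "S = real (card (difference_set A)) + real (f A)"
  have n: "n \<ge> 2" "real n \<ge> 2" using A unfolding n_def by auto
  obtain B where B: "finite B" "B \<subseteq> {0<..}" "n \<le> 4 * card B" "card B \<le> n"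
    "real (card (difference_set B)) + real (f B) \<le> S"
  proof -
    define P N where "P = A \<inter> {0<..}" and "N = A \<inter> {..<0}"
    have PN: "P \<subseteq> A" "N \<subseteq> A" unfolding P_def N_def by auto
    have fin: "finite P" "finite N" using PN A by (auto intro: finite_subset)
    have "A \<subseteq> insert 0 (P \<union> N)" unfolding P_def N_def by auto
    then have "n \<le> card (insert 0 (P \<union> N))" unfolding n_def using fin by (intro card_mono) auto
    also have "\<dots> \<le> 1 + (card P + card N)"
      using card_insert_le_m1 card_Un_le[of P N] by (simp add: card_insert_if fin)
    finally consider "n \<le> 4 * card P" | "n \<le> 4 * card N" using n by linarith
    then show ?thesis
    proof cases
      case 1
      show ?thesis
        by (rule that[of P]) (use 1 fin PN A in \<open>auto simp: P_def S_def n_def intro!: add_mono card_mono mono card_difference_set_mono\<close>)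
    next
      case 2
      have "card (uminus ` N) = card N" by (rule card_image) simp
      moreover have "card N \<le> n" unfolding n_def using PN A by (intro card_mono) auto
      moreover have "uminus ` N \<subseteq> {0<..}" unfolding N_def by auto
      moreover have "card (difference_set N) \<le> card (difference_set A)" "f N \<le> f A"
        using A PN by (auto intro: card_difference_set_mono mono)
      ultimately show ?thesis
        using 2 fin by (intro that[of "uminus ` N"]) (auto simp: S_def card_difference_set_uminus neg)
    qed
  qed
  have "B \<noteq> {}" using B(3) n by auto
  have S: "S \<ge> 0" unfolding S_def by simp
  \<comment> \<open>This is where two elements matter: with \<open>ln n >= 1/2\<close>, the additive
    1 in the bound for \<open>harm n\<close> is absorbed into \<open>3 * ln n\<close>.\<close>
  have ln: "ln (real n) \<ge> 1 / 2"
  proof -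
    have "exp (1 / 2 :: real) ^ 2 = exp 1" by (simp flip: exp_double)
    then have "exp (1 / 2 :: real) ^ 2 \<le> 2 ^ 2" using exp_le by simp
    then have "exp (1 / 2 :: real) \<le> 2" by (rule power2_le_imp_le) simp
    then show ?thesis using n by (subst ln_ge_iff) linarith+
  qed
  have h: "harm (card B) \<le> 3 * ln (real n)"
  proof -
    have "harm (card B) \<le> (harm n :: real)" using B by (intro harm_mono) auto
    also have "\<dots> \<le> 1 + ln (real n)" using n by (intro harm_le_ln) auto
    also have "\<dots> \<le> 3 * ln (real n)" using ln by linarith
    finally show ?thesis .
  qed
  have "real n powr e \<le> (4 * real (card B)) powr e"
    using B(3) e by (intro powr_mono2) auto
  also have "\<dots> = 4 powr e * real (card B) powr e" by (simp add: powr_mult)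
  also have "\<dots> \<le> 4 powr e * (C * harm (card B) ^ k * (real (card (difference_set B)) + real (f B)))"
    using pos[OF B(1) \<open>B \<noteq> {}\<close> B(2)] by (intro mult_left_mono) auto
  also have "\<dots> \<le> 4 powr e * (C * (3 * ln (real n)) ^ k * S)"
    using B(5) C h ln S by (intro mult_left_mono mult_mono power_mono) (auto simp: harm_nonneg)
  also have "\<dots> = 4 powr e * C * 3 ^ k * (S * ln (real n) powr real k)"
    using ln by (simp add: power_mult_distrib powr_realpow)
  finally show "\<bar>real (card A) powr e\<bar>
    \<le> 4 powr e * C * 3 ^ k * \<bar>(real (card (difference_set A)) + real (f A)) * ln (real (card A)) powr real k\<bar>"
    unfolding S_def[symmetric] n_def[symmetric] using S by simp
qed

lemma card_difference_or_quotient_set_ge: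
  fixes A :: "real set"
  assumes A: "finite A" "A \<noteq> {}" "A \<subseteq> {0<..}"
  shows "real (card A) powr (1 + 3 / 10) \<le> 2 ^ 14 * 49392 ^ 3 * harm (card A) ^ 3
    * (real (card (difference_set A)) + real (card (product_set A (inverse_set A))))"
proof -
  define n h c where "n = real (card A)" and "h = (harm (card A) :: real)" and "c = (49392 :: real)"
  define D R where "D = real (card (difference_set A))" and "R = real (card (product_set A (inverse_set A)))"
  have n: "n \<ge> 1" unfolding n_def using A by (simp add: Suc_le_eq card_gt_0_iff)
  have h: "h \<ge> 1" unfolding h_def using A by (intro one_le_harm) (simp add: card_gt_0_iff)
  have DR: "D \<ge> 0" "R \<ge> 0" unfolding D_def R_def by auto
  \<comment> \<open>Balances the two alternatives: the energy constants \<open>K\<close> and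
    \<open>n / K\<close> coincide, and \<open>n^8\<close> is compared with \<open>K^3 * S^5\<close>,
    where 8 - 3/2 = 5 * 13/10.\<close>
  define K where "K = n powr (1 / 2)"
  have K: "K > 0" unfolding K_def using n by simp
  obtain X where X: "X \<subseteq> A" "card A \<le> 2 * card X"
    and dich: "cubic_energy_bound X K \<or> cubic_energy_bound (ln ` X) (c * h ^ 5 * n / K)"
    using cubic_energy_dichotomy[OF A K] unfolding c_def h_def n_def by blast
  have finX: "finite X" using X A finite_subset by blast
  have Xne: "X \<noteq> {}" using X A by auto
  have Xpos: "X \<subseteq> {0<..}" using X A by auto
  have "n / 2 \<le> real (card X)" using X(2) unfolding n_def by linarith
  then have "(n / 2) ^ 8 \<le> real (card X) ^ 8" using n by (intro power_mono) auto
  then have X8: "n ^ 8 \<le> 2 ^ 8 * real (card X) ^ 8" by (simp add: power_divide)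
  have nK: "n / K = K"
    unfolding K_def using n powr_add[of n "1 / 2" "1 / 2"] by (simp add: field_simps)
  have main: ?thesis if "n ^ 8 \<le> 2 ^ 14 * c ^ 3 * h ^ 15 * K ^ 3 * S ^ 5" "0 \<le> S" "S \<le> D + R" for S
  proof -
    have "(n powr (1 + 3 / 10)) ^ 5 * K ^ 3 = n powr real 8"
      unfolding K_def using n by (simp add: powr_power flip: powr_add)
    also have "\<dots> = n ^ 8" using n by (simp only: powr_realpow)
    also note that(1)
    also have "2 ^ 14 * c ^ 3 * h ^ 15 * K ^ 3 * S ^ 5 = (2 ^ 14 * c ^ 3 * h ^ 15 * S ^ 5) * K ^ 3" by simp
    finally have "(n powr (1 + 3 / 10)) ^ 5 * K ^ 3 \<le> (2 ^ 14 * c ^ 3 * h ^ 15 * S ^ 5) * K ^ 3" .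
    then have "(n powr (1 + 3 / 10)) ^ 5 \<le> 2 ^ 14 * c ^ 3 * h ^ 15 * S ^ 5"
      by (rule mult_right_le_imp_le) (use K in simp)
    \<comment> \<open>The constant is raised to its fifth power, harmless as it is at least 1, to
      make the right side a perfect fifth power; \<open>h^15\<close> already is one, which fixes the
      exponent 3 of the harmonic number.\<close>
    also have "\<dots> \<le> (2 ^ 14 * c ^ 3) ^ 5 * h ^ 15 * S ^ 5"
      using h that by (intro mult_right_mono self_le_power) (auto simp: c_def)
    also have "\<dots> = (2 ^ 14 * c ^ 3 * h ^ 3 * S) ^ 5" by (simp add: power_mult_distrib flip: power_mult)
    finally have "n powr (1 + 3 / 10) \<le> 2 ^ 14 * c ^ 3 * h ^ 3 * S"
      using h that by (subst (asm) power_mono_iff) (auto simp: c_def)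
    also have "\<dots> \<le> 2 ^ 14 * c ^ 3 * h ^ 3 * (D + R)"
      using h that by (intro mult_left_mono) (auto simp: c_def)
    finally show ?thesis unfolding n_def c_def h_def D_def R_def .
  qed
  show ?thesis
    using dich
  proof
    assume "cubic_energy_bound X K"
    then have "real (card X) ^ 8 \<le> 64 * K ^ 3 * real (card (difference_set X)) ^ 5"
      using card_le_card_diffs[OF finX Xne] unfolding difference_set_eq_diffs by simp
    also have "\<dots> \<le> 64 * K ^ 3 * D ^ 5"
      unfolding D_def using K card_difference_set_mono[OF A(1) X(1)] by (intro mult_left_mono power_mono) auto
    finally have "n ^ 8 \<le> 2 ^ 14 * K ^ 3 * D ^ 5" using X8 by simp
    also have "\<dots> = (2 ^ 14 * K ^ 3 * D ^ 5) * 1" by simp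
    also have "\<dots> \<le> (2 ^ 14 * K ^ 3 * D ^ 5) * (c ^ 3 * h ^ 15)"
      using h K DR mult_mono[of 1 "c ^ 3" 1 "h ^ 15"] by (intro mult_left_mono) (auto simp: c_def)
    finally show ?thesis using DR by (intro main[of D]) (simp_all add: mult_ac)
  next
    assume "cubic_energy_bound (ln ` X) (c * h ^ 5 * n / K)"
    then have "real (card (ln ` X)) ^ 8 \<le> 64 * (c * h ^ 5 * n / K) ^ 3 * real (card (product_set X (inverse_set X))) ^ 5"
      using card_le_card_diffs[of "ln ` X"] finX Xne unfolding card_diffs_ln[OF Xpos] by simp
    also have "card (ln ` X) = card X" by (rule card_image[OF inj_on_ln_pos[OF Xpos]])
    also have "c * h ^ 5 * n / K = c * h ^ 5 * K" by (simp add: nK flip: times_divide_eq_right)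
    also have "64 * (c * h ^ 5 * K) ^ 3 * real (card (product_set X (inverse_set X))) ^ 5
      = 64 * c ^ 3 * h ^ 15 * K ^ 3 * real (card (product_set X (inverse_set X))) ^ 5" by algebra
    also have "\<dots> \<le> 64 * c ^ 3 * h ^ 15 * K ^ 3 * R ^ 5"
      unfolding R_def using K h card_quotient_set_mono[OF A(1) X(1)]
      by (intro mult_left_mono power_mono) (simp_all add: c_def)
    finally have "n ^ 8 \<le> 2 ^ 14 * c ^ 3 * h ^ 15 * K ^ 3 * R ^ 5" using X8 by simp
    then show ?thesis using DR by (intro main[of R]) simp_all
  qed
qed

lemma card_difference_or_product_set_ge:
  fixes A :: "real set"
  assumes A: "finite A" "A \<noteq> {}" "A \<subseteq> {0<..}"
  shows "real (card A) powr (1 + 7 / 24) \<le> 2 ^ 39 * 49392 ^ 4 * harm (card A) ^ 4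
    * (real (card (difference_set A)) + real (card (product_set A A)))"
proof -
  define n h c where "n = real (card A)" and "h = (harm (card A) :: real)" and "c = (49392 :: real)"
  define D R where "D = real (card (difference_set A))" and "R = real (card (product_set A A))"
  define e where "e = n powr (1 + 7 / 24)"
  have n: "n \<ge> 1" unfolding n_def using A by (simp add: Suc_le_eq card_gt_0_iff)
  have h: "h \<ge> 1" unfolding h_def using A by (intro one_le_harm) (simp add: card_gt_0_iff)
  have DR: "D \<ge> 0" "R \<ge> 0" unfolding D_def R_def by auto
  have nat_powr: "n powr real m = n ^ m" for m using n by (simp add: powr_realpow)
  \<comment> \<open>The exponent is chosen so that the difference alternative gives exactly 8/5 -
    (3/5) * (37/72) = 31/24. The product alternative then gives 1 + (4/7) * (37/72) = 1 + 37/126,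
    which is slightly more.\<close>
  define K where "K = n powr (37 / 72)"
  have K: "K > 0" unfolding K_def using n by simp
  obtain X where X: "X \<subseteq> A" "card A \<le> 2 * card X"
    and dich: "cubic_energy_bound X K \<or> cubic_energy_bound (ln ` X) (c * h ^ 5 * n / K)"
    using cubic_energy_dichotomy[OF A K] unfolding c_def h_def n_def by blast
  have finX: "finite X" using X A finite_subset by blast
  have Xne: "X \<noteq> {}" using X A by auto
  have Xpos: "X \<subseteq> {0<..}" using X A by auto
  have half: "n / 2 \<le> real (card X)" using X(2) unfolding n_def by linarith
  have "e \<le> 2 ^ 39 * c ^ 4 * h ^ 4 * (D + R)"
    using dich
  proof
    assume "cubic_energy_bound X K"
    then have "real (card X) ^ 8 \<le> 64 * K ^ 3 * real (card (difference_set X)) ^ 5"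
      using card_le_card_diffs[OF finX Xne] unfolding difference_set_eq_diffs by simp
    also have "\<dots> \<le> 64 * K ^ 3 * D ^ 5"
      unfolding D_def using K card_difference_set_mono[OF A(1) X(1)] by (intro mult_left_mono power_mono) auto
    finally have X8: "real (card X) ^ 8 \<le> 64 * K ^ 3 * D ^ 5" .
    have "(n / 2) ^ 8 \<le> real (card X) ^ 8" using n half by (intro power_mono) auto
    also note X8
    finally have "n ^ 8 \<le> 2 ^ 14 * D ^ 5 * K ^ 3" by (simp add: power_divide mult_ac)
    moreover have "e ^ 5 * K ^ 3 = n powr real 8"
      unfolding e_def K_def using n by (simp add: powr_power flip: powr_add)
    ultimately have "e ^ 5 * K ^ 3 \<le> 2 ^ 14 * D ^ 5 * K ^ 3" unfolding nat_powr by simp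
    then have "e ^ 5 \<le> 2 ^ 14 * D ^ 5" by (rule mult_right_le_imp_le) (use K in simp)
    also have "\<dots> \<le> (2 ^ 14) ^ 5 * D ^ 5" using DR by (intro mult_right_mono) auto
    also have "\<dots> = (2 ^ 14 * D) ^ 5" by (simp add: power_mult_distrib)
    finally have "e \<le> 2 ^ 14 * D"
      using DR by (subst (asm) power_mono_iff) (auto simp: e_def)
    also have "\<dots> \<le> (2 ^ 39 * c ^ 4 * h ^ 4) * (D + R)"
    proof (rule mult_mono)
      have "(2 ^ 14 :: real) * 1 \<le> (2 ^ 39 * c ^ 4) * h ^ 4"
        using h by (intro mult_mono) (auto simp: c_def)
      then show "2 ^ 14 \<le> 2 ^ 39 * c ^ 4 * h ^ 4" by simp
    qed (use DR h in \<open>auto simp: c_def\<close>)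
    finally show ?thesis .
  next
    define d where "d = c * h ^ 5 * n / K"
    have d: "d \<ge> 0" unfolding d_def using h n K by (auto simp: c_def)
    assume "cubic_energy_bound (ln ` X) (c * h ^ 5 * n / K)"
    then have "real (card (ln ` X)) ^ 11 \<le> 2 ^ 28 * harm (card (ln ` X)) ^ 2 * d ^ 4 * real (card (product_set X X)) ^ 7"
      using card_le_card_sums[of "ln ` X"] finX Xne unfolding card_sumset_ln[OF Xpos] d_def by simp
    also have "card (ln ` X) = card X" by (rule card_image[OF inj_on_ln_pos[OF Xpos]])
    also have "2 ^ 28 * harm (card X) ^ 2 * d ^ 4 * real (card (product_set X X)) ^ 7
      \<le> 2 ^ 28 * h ^ 2 * d ^ 4 * R ^ 7"
      unfolding R_def h_def using d card_product_set_mono[OF A(1) X(1)] card_mono[OF A(1) X(1)]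
      by (intro mult_mono power_mono harm_mono) (auto simp: harm_nonneg)
    finally have X11: "real (card X) ^ 11 \<le> 2 ^ 28 * h ^ 2 * d ^ 4 * R ^ 7" .
    have "(n / 2) ^ 11 \<le> real (card X) ^ 11" using n half by (intro power_mono) auto
    also note X11
    finally have 1: "n ^ 11 \<le> 2 ^ 39 * h ^ 2 * d ^ 4 * R ^ 7" by (simp add: power_divide)
    \<comment> \<open>The exponent on the left is 791/72, just below 11 = 792/72.\<close>
    have "e ^ 7 * (n / K) ^ 4 \<le> n ^ 11"
    proof -
      have "n / K = n powr (35 / 72)"
        unfolding K_def using n powr_diff[of n 1 "37 / 72"] by simp
      then have "e ^ 7 * (n / K) ^ 4 = n powr (217 / 24 + 35 / 18)"
        unfolding e_def using n by (simp add: powr_power flip: powr_add)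
      also have "\<dots> \<le> n powr real 11" using n by (intro powr_mono) auto
      finally show ?thesis unfolding nat_powr .
    qed
    also note 1
    also have "d = c * h ^ 5 * (n / K)" unfolding d_def by simp
    also have "2 ^ 39 * h ^ 2 * (c * h ^ 5 * (n / K)) ^ 4 * R ^ 7 = (2 ^ 39 * c ^ 4 * h ^ 22 * R ^ 7) * (n / K) ^ 4"
      by algebra
    finally have "e ^ 7 \<le> 2 ^ 39 * c ^ 4 * h ^ 22 * R ^ 7"
      by (rule mult_right_le_imp_le) (use n K in simp)
    \<comment> \<open>As 22 = 2 + 4 * 5 is not a multiple of 7, it is raised to 28 before the
      seventh root is taken; this produces the fourth power of the harmonic number.\<close>
    also have "\<dots> \<le> (2 ^ 39 * c ^ 4) ^ 7 * h ^ 28 * R ^ 7"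
    proof (intro mult_right_mono mult_mono self_le_power)
      show "h ^ 22 \<le> h ^ 28" using h by (intro power_increasing) simp_all
    qed (use h DR in \<open>simp_all add: c_def\<close>)
    also have "\<dots> = (2 ^ 39 * c ^ 4 * h ^ 4 * R) ^ 7" by algebra
    finally have "e \<le> 2 ^ 39 * c ^ 4 * h ^ 4 * R"
      using h DR by (subst (asm) power_mono_iff) (auto simp: c_def e_def)
    also have "\<dots> \<le> 2 ^ 39 * c ^ 4 * h ^ 4 * (D + R)"
      using h DR by (intro mult_left_mono) (auto simp: c_def)
    finally show ?thesis .
  qed
  then show ?thesis unfolding e_def n_def c_def h_def D_def R_def .
qed

theorem theorem1p13:
  shows "((\<lambda>A. real (card (difference_set A)) + real (card (product_set A (inverse_set A))))
           \<greatersim> (\<lambda>A. real (card A) powr (1 + 3 / 10))) \<and>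
         ((\<lambda>A. real (card (difference_set A)) + real (card (product_set A A)))
           \<greatersim> (\<lambda>A. real (card A) powr (1 + 7 / 24)))"
proof
  show "(\<lambda>A. real (card (difference_set A)) + real (card (product_set A (inverse_set A))))
           \<greatersim> (\<lambda>A. real (card A) powr (1 + 3 / 10))"
    by (rule gtrsim_of_positive[where C = "2 ^ 14 * 49392 ^ 3" and k = 3])
       (use card_difference_or_quotient_set_ge in
         \<open>auto simp: quotient_set_uminus intro: card_quotient_set_mono\<close>)
  show "(\<lambda>A. real (card (difference_set A)) + real (card (product_set A A)))
           \<greatersim> (\<lambda>A. real (card A) powr (1 + 7 / 24))"
    by (rule gtrsim_of_positive[where C = "2 ^ 39 * 49392 ^ 4" and k = 4])
       (use card_difference_or_product_set_ge in
         \<open>auto simp: product_set_uminus intro: card_product_set_mono\<close>)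
qed

end
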